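(* Let $\Omega\subset\mathbb C^n$ be a bounded open set and $q\in\mathbb R$, $q>1$. Suppose that for every $\eta\in\partial\Omega$ and every $\varepsilon>0$ there exists $f_{\eta,\varepsilon}\in\bigcap_{p<q}\mathcal{O}L^p(\Omega)$ with $\int_{B(\eta,\varepsilon)\cap\Omega}|f_{\eta,\varepsilon}|^q\,dv=+\infty$. Then the set $$\mathcal S(\Omega,q)=\Big\{g\in\bigcap_{p<q}\mathcal{O}L^p(\Omega): \int_{B(\zeta,\varepsilon)\cap\Omega}|g|^q\,dv=+\infty\ \text{for every }\zeta\in\partial\Omega\text{ and every }\varepsilon>0\Big\}$$ is dense and $G_\delta$ in $\bigcap_{p<q}\mathcal{O}L^p(\Omega)$.
   Context: For a bounded open $\Omega\subset\mathbb C^n$ and $p\ge1$, $\mathcal{O}L^p(\Omega)$ is the Banach space of holomorphic $f$ on $\Omega$ with $\|f\|_p=(\int_\Omega|f|^p\,dv)^{1/p}<\infty$. For $q>1$, $\bigcap_{p<q}\mathcal{O}L^p(\Omega)$ carries the complete metric $d(f,g)=\sum_j2^{-j}\frac{\|f-g\|_{p_j}}{1+\|f-g\|_{p_j}}$ with $1<p_1<p_2<\dots$, $p_j\to q$; convergence means $\|f_k-f\|_p\to0$ for all $p<q$. *)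

theory Defs
  imports "HOL-Analysis.Analysis"
begin

definition holo_on :: "(complex ^ 'n) set \<Rightarrow> (complex ^ 'n \<Rightarrow> complex) \<Rightarrow> bool" where
  "holo_on \<Omega> f \<longleftrightarrow> (\<forall>z\<in>\<Omega>. \<exists>D. (f has_derivative D) (at z) \<and> (\<forall>c v. D (c *s v) = c * D v))"

definition Lp_int :: "(complex ^ 'n) set \<Rightarrow> real \<Rightarrow> (complex ^ 'n \<Rightarrow> complex) \<Rightarrow> ennreal" where
  "Lp_int A p f = (\<integral>\<^sup>+ z\<in>A. ennreal (norm (f z) powr p) \<partial>lebesgue)"

definition Lp_norm :: "(complex ^ 'n) set \<Rightarrow> real \<Rightarrow> (complex ^ 'n \<Rightarrow> complex) \<Rightarrow> real" where
  "Lp_norm \<Omega> p f = (enn2real (Lp_int \<Omega> p f)) powr (1 / p)"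

text \<open>The space \<Inter>_{p<q} OL^p(\<Omega>); functions are normalised to be 0 outside \<Omega>.\<close>
definition OLp_below :: "(complex ^ 'n) set \<Rightarrow> real \<Rightarrow> (complex ^ 'n \<Rightarrow> complex) set" where
  "OLp_below \<Omega> q = {f. holo_on \<Omega> f \<and> (\<forall>z. z \<notin> \<Omega> \<longrightarrow> f z = 0) \<and>
                        (\<forall>p. 1 \<le> p \<and> p < q \<longrightarrow> Lp_int \<Omega> p f < \<infinity>)}"

text \<open>The exponents p_j = q - (q-1)/(j+1), j = 1,2,..., so 1 < p_1 < p_2 < ... -> q.\<close>
definition pexp :: "real \<Rightarrow> nat \<Rightarrow> real" where
  "pexp q j = q - (q - 1) / (real j + 1)"

definition OLp_dist :: "(complex ^ 'n) set \<Rightarrow> real \<Rightarrow> (complex ^ 'n \<Rightarrow> complex) \<Rightarrow> (complex ^ 'n \<Rightarrow> complex) \<Rightarrow> real" where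
  "OLp_dist \<Omega> q f g = (\<Sum>j. (1/2) ^ (Suc j) *
       (Lp_norm \<Omega> (pexp q (Suc j)) (f - g) / (1 + Lp_norm \<Omega> (pexp q (Suc j)) (f - g))))"

definition OLp_topology :: "(complex ^ 'n) set \<Rightarrow> real \<Rightarrow> (complex ^ 'n \<Rightarrow> complex) topology" where
  "OLp_topology \<Omega> q = Metric_space.mtopology (OLp_below \<Omega> q) (OLp_dist \<Omega> q)"

definition S_set :: "(complex ^ 'n) set \<Rightarrow> real \<Rightarrow> (complex ^ 'n \<Rightarrow> complex) set" where
  "S_set \<Omega> q = {g \<in> OLp_below \<Omega> q. \<forall>\<zeta>\<in>frontier \<Omega>. \<forall>\<epsilon>>0. Lp_int (ball \<zeta> \<epsilon> \<inter> \<Omega>) q g = \<infinity>}"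

end

theory Submission
  imports Defs "HOL-Complex_Analysis.Cauchy_Integral_Formula"
begin

text \<open>
  Write \<open>p\<^sub>j\<close> for the exponents increasing to \<open>q\<close>. For \<open>A \<subseteq> \<Omega>\<close>, Fatou's lemma shows that \<open>|g|\<^sup>q\<close> has
  infinite integral over \<open>A\<close> iff the \<open>L\<close>-norms of \<open>g\<close> over \<open>A\<close> with exponents \<open>p\<^sub>j\<close> are unbounded in
  \<open>j\<close>. Exceeding a bound for some \<open>j\<close> is an open condition on \<open>g\<close>, and countably many balls centred in a
  dense subset of the boundary suffice, so the set of singular functions is \<open>G\<^sub>\<delta>\<close>.

  For density, completeness of the metric is not needed. Given \<open>g\<^sub>0\<close> and functions \<open>f\<^sub>k\<close>, singular on
  the \<open>k\<close>-th ball and scaled so that they are small on a compact exhaustion and in the norms up to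
  \<open>p\<^sub>k\<close>, every bounded real sequence \<open>a\<close> gives an element \<open>g\<^sub>0 + \<Sum>\<^sub>k 2\<^bsup>-k-1\<^esup> a\<^sub>k f\<^sub>k\<close> of the space, by
  Cauchy estimates along complex lines. The sequences whose \<open>p\<^sub>j\<close>-norms over the \<open>k\<close>-th ball are all
  bounded by \<open>N\<close> form a closed set without interior, since moving \<open>a\<^sub>k\<close> adds a multiple of \<open>f\<^sub>k\<close>.
  Baire's theorem in the Banach space of bounded sequences therefore yields arbitrarily small \<open>a\<close>
  giving a singular function.
\<close>

section \<open>Convexity of real powers\<close>

lemma powr_convex_combination:
  fixes x y t p :: real
  assumes "1 \<le> p" "0 \<le> x" "0 \<le> y" "0 \<le> t" "t \<le> 1"
  shows "((1 - t) * x + t * y) powr p \<le> (1 - t) * x powr p + t * y powr p"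
proof -
  \<comment> \<open>Covers the boundary case: if \<open>x\<close> or \<open>y\<close> is 0, the
    claim reduces to this inequality for the other one.\<close>
  have shrink: "(s * w) powr p \<le> s * w powr p" if "0 \<le> s" "s \<le> 1" "0 \<le> w" for s w :: real
  proof -
    have "s powr p \<le> s powr 1" if "s > 0"
      using that \<open>s \<le> 1\<close> assms(1) by (intro powr_mono') auto
    then have "s powr p \<le> s"
      using that by (cases "s = 0") auto
    then show ?thesis
      using that by (simp add: powr_mult mult_right_mono)
  qed
  show ?thesis
  proof (cases "x = 0 \<or> y = 0")
    case True
    then show ?thesis
      using shrink[of t y] shrink[of "1 - t" x] assms by auto
  next
    case False
    then show ?thesis
      using convex_onD[OF powr_convex[OF assms(1)], of t x y] assms by auto
  qed
qed

text \<open>Convexity at the points \<open>u / \<alpha>\<close> and \<open>v / \<beta>\<close> with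
  weights \<open>\<alpha> / (\<alpha> + \<beta>)\<close> and
  \<open>\<beta> / (\<alpha> + \<beta>)\<close>. With bounds on two norms as \<alpha> and \<beta>,
  integration yields Minkowski's inequality with its sharp constant.\<close>

lemma powr_add_le_weighted:
  fixes u v \<alpha> \<beta> p :: real
  assumes "1 \<le> p" "0 \<le> u" "0 \<le> v" "0 < \<alpha>" "0 < \<beta>"
  shows "(u + v) powr p \<le> (\<alpha> + \<beta>) powr (p - 1) * (\<alpha> powr (1 - p) * u powr p + \<beta> powr (1 - p) * v powr p)"
proof -
  define s where "s = \<alpha> + \<beta>"
  have s: "s > 0" "s \<noteq> 0" using assms by (auto simp: s_def)
  have t: "1 - \<beta> / s = \<alpha> / s" using s by (simp add: s_def field_simps)
  have eq: "\<alpha> / s * (u / \<alpha>) + \<beta> / s * (v / \<beta>) = (u + v) / s"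
    using assms s by (simp add: field_simps)
  have w: "s powr p * (a / s * (w / a) powr p) = s powr (p - 1) * (a powr (1 - p) * w powr p)"
    if "a > 0" "w \<ge> 0" for a w
    using that s by (simp add: powr_divide powr_diff field_simps)
  have "((u + v) / s) powr p \<le> \<alpha> / s * (u / \<alpha>) powr p + \<beta> / s * (v / \<beta>) powr p"
    using powr_convex_combination[of p "u / \<alpha>" "v / \<beta>" "\<beta> / s"] assms s eq
    unfolding t by (simp add: s_def)
  then have "s powr p * ((u + v) / s) powr p
      \<le> s powr p * (\<alpha> / s * (u / \<alpha>) powr p + \<beta> / s * (v / \<beta>) powr p)"
    by (intro mult_left_mono) auto
  also have "\<dots> = s powr (p - 1) * (\<alpha> powr (1 - p) * u powr p + \<beta> powr (1 - p) * v powr p)"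
    using assms by (simp only: distrib_left w)
  finally show ?thesis
    using s assms by (simp add: powr_divide s_def)
qed

section \<open>Integrals of powers and Minkowski's inequality\<close>

lemma Lp_int_mono:
  assumes "0 \<le> p" "A \<subseteq> B" "\<And>z. z \<in> A \<Longrightarrow> norm (f z) \<le> norm (g z)"
  shows "Lp_int A p f \<le> Lp_int B p g"
  unfolding Lp_int_def using assms
  by (intro nn_integral_mono) (auto simp: indicator_def intro!: ennreal_leI powr_mono2)

lemma Lp_int_cong:
  assumes "\<And>z. z \<in> A \<Longrightarrow> norm (f z) = norm (g z)"
  shows "Lp_int A p f = Lp_int A p g"
  unfolding Lp_int_def using assms
  by (intro nn_integral_cong) (auto simp: indicator_def)

lemma Lp_int_mult:
  assumes "f \<in> borel_measurable lebesgue" "A \<in> sets lebesgue"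
  shows "Lp_int A p (\<lambda>z. c * f z) = ennreal (norm c powr p) * Lp_int A p f"
  unfolding Lp_int_def using assms
  by (subst nn_integral_cmult[symmetric]) (auto simp: norm_mult powr_mult ennreal_mult mult.assoc)

text \<open>Pointwise \<open>x powr p \<le> 1 + x powr r\<close>, by distinguishing
  \<open>x \<le> 1\<close> from \<open>x > 1\<close>. The bound does not depend on \<open>p\<close>,
  so one constant serves all exponents up to \<open>r\<close>.\<close>

lemma Lp_int_le_lower_exponent:
  assumes "f \<in> borel_measurable lebesgue" "A \<in> sets lebesgue" "0 \<le> p" "p \<le> r"
  shows "Lp_int A p f \<le> emeasure lebesgue A + Lp_int A r f"
proof -
  have *: "x powr p \<le> 1 + x powr r" if "x \<ge> 0" for x :: real
  proof (cases "x \<le> 1")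
    case True
    then have "x powr p \<le> 1" using that assms by (simp add: powr_le1)
    then show ?thesis by (smt (verit) powr_ge_zero)
  next
    case False
    then have "x powr p \<le> x powr r" using assms by (intro powr_mono) auto
    then show ?thesis by simp
  qed
  have "Lp_int A p f \<le> (\<integral>\<^sup>+ z. indicator A z + ennreal (norm (f z) powr r) * indicator A z \<partial>lebesgue)"
    unfolding Lp_int_def
  proof (intro nn_integral_mono)
    fix z
    have "ennreal (norm (f z) powr p) \<le> 1 + ennreal (norm (f z) powr r)"
      using * [of "norm (f z)"] by (metis ennreal_1 ennreal_leI ennreal_plus norm_ge_zero powr_ge_zero zero_le_one)
    then show "ennreal (norm (f z) powr p) * indicator A z
        \<le> indicator A z + ennreal (norm (f z) powr r) * indicator A z"
      by (simp add: indicator_def)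
  qed
  also have "\<dots> = emeasure lebesgue A + Lp_int A r f"
    unfolding Lp_int_def using assms by (subst nn_integral_add) auto
  finally show ?thesis .
qed

lemma Lp_norm_leI:
  assumes "0 < p" "0 \<le> \<alpha>" "Lp_int A p f \<le> ennreal (\<alpha> powr p)"
  shows "Lp_norm A p f \<le> \<alpha>"
proof -
  have "enn2real (Lp_int A p f) \<le> \<alpha> powr p"
    using assms by (simp add: enn2real_leI)
  then have "Lp_norm A p f \<le> (\<alpha> powr p) powr (1 / p)"
    unfolding Lp_norm_def using assms by (intro powr_mono2) auto
  then show ?thesis using assms by (simp add: powr_powr)
qed

lemma Lp_int_eq_Lp_norm_powr:
  assumes "0 < p" "Lp_int A p f < \<infinity>"
  shows "Lp_int A p f = ennreal (Lp_norm A p f powr p)"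
  using assms by (simp add: Lp_norm_def powr_powr)

lemma Lp_norm_nonneg: "0 \<le> Lp_norm A p f"
  by (simp add: Lp_norm_def)

lemma Lp_norm_mono:
  assumes "0 < p" "A \<subseteq> B" "\<And>z. z \<in> A \<Longrightarrow> norm (f z) \<le> norm (g z)" "Lp_int B p g < \<infinity>"
  shows "Lp_norm A p f \<le> Lp_norm B p g"
  unfolding Lp_norm_def using assms Lp_int_mono[of p A B f g]
  by (intro powr_mono2 enn2real_mono) auto

lemma Lp_norm_cong:
  assumes "\<And>z. z \<in> A \<Longrightarrow> norm (f z) = norm (g z)"
  shows "Lp_norm A p f = Lp_norm A p g"
  by (simp add: Lp_norm_def Lp_int_cong[OF assms])

lemma Lp_norm_mult:
  assumes "f \<in> borel_measurable lebesgue" "A \<in> sets lebesgue" "0 < p"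
  shows "Lp_norm A p (\<lambda>z. c * f z) = norm c * Lp_norm A p f"
  using assms
  by (simp add: Lp_norm_def Lp_int_mult enn2real_mult powr_mult powr_powr)

text \<open>Integrating \<open>powr_add_le_weighted\<close> gives
  \<open>(\<alpha> + \<beta>) powr (p - 1) * (\<alpha> + \<beta>)\<close>. Positive upper bounds
  replace the norms, which may vanish and could then not be divided by.\<close>

lemma Lp_int_add_le:
  assumes meas: "f \<in> borel_measurable lebesgue" "g \<in> borel_measurable lebesgue" "A \<in> sets lebesgue"
    and p: "1 \<le> p" and pos: "0 < \<alpha>" "0 < \<beta>"
    and f: "Lp_int A p f \<le> ennreal (\<alpha> powr p)" and g: "Lp_int A p g \<le> ennreal (\<beta> powr p)"
  shows "Lp_int A p (\<lambda>z. f z + g z) \<le> ennreal ((\<alpha> + \<beta>) powr p)"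
proof -
  define c d where "c = (\<alpha> + \<beta>) powr (p - 1) * \<alpha> powr (1 - p)"
    and "d = (\<alpha> + \<beta>) powr (p - 1) * \<beta> powr (1 - p)"
  have cd: "c \<ge> 0" "d \<ge> 0" by (auto simp: c_def d_def)
  have "Lp_int A p (\<lambda>z. f z + g z) \<le>
      (\<integral>\<^sup>+ z. ennreal c * (ennreal (norm (f z) powr p) * indicator A z)
           + ennreal d * (ennreal (norm (g z) powr p) * indicator A z) \<partial>lebesgue)"
    unfolding Lp_int_def
  proof (intro nn_integral_mono)
    fix z
    have "norm (f z + g z) powr p \<le> (norm (f z) + norm (g z)) powr p"
      using p by (intro powr_mono2 norm_triangle_ineq) auto
    also have "\<dots> \<le> c * norm (f z) powr p + d * norm (g z) powr p"
      using powr_add_le_weighted[OF p, of "norm (f z)" "norm (g z)" \<alpha> \<beta>] pos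
      by (simp add: c_def d_def algebra_simps)
    finally have "ennreal (norm (f z + g z) powr p)
        \<le> ennreal c * ennreal (norm (f z) powr p) + ennreal d * ennreal (norm (g z) powr p)"
      using cd by (simp flip: ennreal_mult ennreal_plus)
    then show "ennreal (norm (f z + g z) powr p) * indicator A z
        \<le> ennreal c * (ennreal (norm (f z) powr p) * indicator A z)
           + ennreal d * (ennreal (norm (g z) powr p) * indicator A z)"
      by (simp add: indicator_def)
  qed
  also have "\<dots> = ennreal c * Lp_int A p f + ennreal d * Lp_int A p g"
    unfolding Lp_int_def using meas by (simp add: nn_integral_add nn_integral_cmult)
  also have "\<dots> \<le> ennreal c * ennreal (\<alpha> powr p) + ennreal d * ennreal (\<beta> powr p)"
    using f g by (intro add_mono mult_left_mono) auto
  also have "\<dots> = ennreal (c * \<alpha> powr p + d * \<beta> powr p)"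
    using cd by (simp add: ennreal_mult)
  also have "c * \<alpha> powr p + d * \<beta> powr p = (\<alpha> + \<beta>) powr (p - 1) * (\<alpha> + \<beta>)"
  proof -
    have "a powr (1 - p) * a powr p = a" if "a > 0" for a :: real
      using that by (simp flip: powr_add)
    then show ?thesis
      using pos by (simp add: c_def d_def mult.assoc distrib_left)
  qed
  also have "\<dots> = (\<alpha> + \<beta>) powr p"
    using pos by (simp add: powr_diff)
  finally show ?thesis .
qed

lemma Lp_int_add_finite:
  assumes "f \<in> borel_measurable lebesgue" "g \<in> borel_measurable lebesgue" "A \<in> sets lebesgue"
    and "1 \<le> p" "Lp_int A p f < \<infinity>" "Lp_int A p g < \<infinity>"
  shows "Lp_int A p (\<lambda>z. f z + g z) < \<infinity>"
proof -
  have "Lp_int A p h \<le> ennreal ((Lp_norm A p h + 1) powr p)" if "Lp_int A p h < \<infinity>" for h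
    using that assms by (subst Lp_int_eq_Lp_norm_powr) (auto intro!: ennreal_leI powr_mono2 Lp_norm_nonneg)
  then have "Lp_int A p (\<lambda>z. f z + g z) \<le> ennreal ((Lp_norm A p f + 1 + (Lp_norm A p g + 1)) powr p)"
    using assms Lp_norm_nonneg by (intro Lp_int_add_le) (auto intro!: add_nonneg_pos)
  then show ?thesis
    by (simp add: order_le_less_trans)
qed

text \<open>Each norm is enlarged by \<open>e/2\<close> to meet the positivity demanded by
  \<open>Lp_int_add_le\<close>; then \<open>e\<close> is arbitrary.\<close>

lemma Lp_norm_triangle:
  assumes "f \<in> borel_measurable lebesgue" "g \<in> borel_measurable lebesgue" "A \<in> sets lebesgue"
    and "1 \<le> p" "Lp_int A p f < \<infinity>" "Lp_int A p g < \<infinity>"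
  shows "Lp_norm A p (\<lambda>z. f z + g z) \<le> Lp_norm A p f + Lp_norm A p g"
proof (rule field_le_epsilon)
  fix e :: real assume "e > 0"
  have "Lp_int A p h \<le> ennreal ((Lp_norm A p h + e/2) powr p)" if "Lp_int A p h < \<infinity>" for h
    using that assms \<open>e > 0\<close>
    by (subst Lp_int_eq_Lp_norm_powr) (auto intro!: ennreal_leI powr_mono2 Lp_norm_nonneg)
  then have "Lp_int A p (\<lambda>z. f z + g z) \<le> ennreal ((Lp_norm A p f + e/2 + (Lp_norm A p g + e/2)) powr p)"
    using assms Lp_norm_nonneg \<open>e > 0\<close> by (intro Lp_int_add_le) (auto intro!: add_nonneg_pos)
  then have "Lp_norm A p (\<lambda>z. f z + g z) \<le> Lp_norm A p f + e/2 + (Lp_norm A p g + e/2)"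
    using assms \<open>e > 0\<close> by (intro Lp_norm_leI) (auto intro!: add_nonneg_nonneg Lp_norm_nonneg)
  then show "Lp_norm A p (\<lambda>z. f z + g z) \<le> Lp_norm A p f + Lp_norm A p g + e"
    by simp
qed

section \<open>Exponents increasing to \<open>q\<close>\<close>

text \<open>The shift to \<open>Suc j\<close> skips \<open>pexp q 0 = 1\<close>, so the first
  inequality is strict.\<close>

lemma pexp_bounds:
  assumes "1 < q"
  shows "1 < pexp q (Suc j)" "pexp q (Suc j) < q"
proof -
  have "(q - 1) / (real (Suc j) + 1) < q - 1"
    using mult_strict_left_mono[of 1 "real (Suc j) + 1" "q - 1"] assms
    by (simp add: pos_divide_less_eq)
  then show "1 < pexp q (Suc j)" by (simp add: pexp_def)
  show "pexp q (Suc j) < q" using assms by (simp add: pexp_def)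
qed

lemma pexp_tendsto: "(\<lambda>j. pexp q (Suc j)) \<longlonglongrightarrow> q"
proof -
  have "(\<lambda>j. q - (q - 1) * inverse (real (Suc (Suc j)))) \<longlonglongrightarrow> q - (q - 1) * 0"
    by (intro tendsto_intros LIMSEQ_Suc[OF LIMSEQ_inverse_real_of_nat])
  then show ?thesis
    by (simp add: pexp_def field_simps)
qed

text \<open>The backward direction is Fatou's lemma as the exponent increases to \<open>q\<close>.\<close>

lemma Lp_int_finite_iff_Lp_norms_bounded:
  assumes meas: "f \<in> borel_measurable lebesgue" "A \<in> sets lebesgue"
    and A: "emeasure lebesgue A < \<infinity>" and q: "1 < q"
    and fin: "\<And>p. 1 \<le> p \<Longrightarrow> p < q \<Longrightarrow> Lp_int A p f < \<infinity>"
  shows "Lp_int A q f < \<infinity> \<longleftrightarrow> (\<exists>N::nat. \<forall>j. Lp_norm A (pexp q (Suc j)) f \<le> real N)"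
proof
  assume L: "Lp_int A q f < \<infinity>"
  define C where "C = enn2real (emeasure lebesgue A + Lp_int A q f)"
  have C: "emeasure lebesgue A + Lp_int A q f = ennreal C"
    using A L by (simp add: C_def)
  \<comment> \<open>Since \<open>N\<close> is at least 1, raising it to an exponent above 1 only
    enlarges it, so a single \<open>N\<close> bounds all the norms.\<close>
  obtain N :: nat where N: "max 1 C \<le> real N"
    using real_arch_simple by blast
  have "Lp_norm A (pexp q (Suc j)) f \<le> real N" for j
  proof (rule Lp_norm_leI)
    note pb = pexp_bounds[OF q, of j]
    have "Lp_int A (pexp q (Suc j)) f \<le> ennreal C"
      using Lp_int_le_lower_exponent[OF meas, of "pexp q (Suc j)" q] pb C by auto
    also have "C \<le> real N powr 1" using N by simp
    also have "\<dots> \<le> real N powr pexp q (Suc j)"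
      using N pb by (intro powr_mono) auto
    finally show "Lp_int A (pexp q (Suc j)) f \<le> ennreal (real N powr pexp q (Suc j))"
      by (simp add: ennreal_leI)
  qed (use pexp_bounds[OF q, of j] in auto)
  then show "\<exists>N::nat. \<forall>j. Lp_norm A (pexp q (Suc j)) f \<le> real N" by blast
next
  assume "\<exists>N::nat. \<forall>j. Lp_norm A (pexp q (Suc j)) f \<le> real N"
  then obtain N :: nat where N: "\<And>j. Lp_norm A (pexp q (Suc j)) f \<le> real N" by blast
  define u where "u j z = ennreal (norm (f z) powr pexp q (Suc j)) * indicator A z" for j z
  \<comment> \<open>The base \<open>max 1 (real N)\<close> is at least 1, so the exponent may be
    raised to \<open>q\<close>, which frees the bound from \<open>j\<close>.\<close>
  have bound: "integral\<^sup>N lebesgue (u j) \<le> ennreal (max 1 (real N) powr q)" for j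
  proof -
    note pb = pexp_bounds[OF q, of j]
    have "integral\<^sup>N lebesgue (u j) = ennreal (Lp_norm A (pexp q (Suc j)) f powr pexp q (Suc j))"
      using Lp_int_eq_Lp_norm_powr[of "pexp q (Suc j)" A f] fin[of "pexp q (Suc j)"] pb
      by (simp add: u_def[abs_def] Lp_int_def)
    also have "\<dots> \<le> ennreal (max 1 (real N) powr pexp q (Suc j))"
      using N[of j] pb by (intro ennreal_leI powr_mono2) (auto simp: Lp_norm_nonneg)
    also have "\<dots> \<le> ennreal (max 1 (real N) powr q)"
      using pb by (intro ennreal_leI powr_mono) auto
    finally show ?thesis .
  qed
  have lim: "(\<lambda>j. u j z) \<longlonglongrightarrow> ennreal (norm (f z) powr q) * indicator A z" for z
  proof (cases "f z = 0")
    case False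
    then have "(\<lambda>j. ennreal (norm (f z) powr pexp q (Suc j))) \<longlonglongrightarrow> ennreal (norm (f z) powr q)"
      by (intro tendsto_ennrealI tendsto_powr tendsto_const pexp_tendsto) auto
    then show ?thesis
      by (auto simp: u_def indicator_def)
  qed (auto simp: u_def)
  have "Lp_int A q f = (\<integral>\<^sup>+ z. liminf (\<lambda>j. u j z) \<partial>lebesgue)"
    unfolding Lp_int_def using lim
    by (intro nn_integral_cong lim_imp_Liminf[symmetric]) auto
  also have "\<dots> \<le> liminf (\<lambda>j. integral\<^sup>N lebesgue (u j))"
    unfolding u_def using meas by (intro nn_integral_liminf) auto
  also have "\<dots> \<le> ennreal (max 1 (real N) powr q)"
    using bound by (intro Liminf_le) auto
  finally show "Lp_int A q f < \<infinity>"
    by (simp add: order_le_less_trans)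
qed

section \<open>Holomorphic functions of several variables\<close>

lemma norm_vector_scalar_mult:
  fixes c :: complex and v :: "complex ^ 'n"
  shows "norm (c *s v) = norm c * norm v"
  by (simp add: norm_vec_def norm_mult L2_set_right_distrib)

lemma vector_scalar_mult_bounded_linear:
  fixes v :: "complex ^ 'n"
  shows "bounded_linear (\<lambda>t. t *s v)"
  by (rule bounded_linear_intro[where K="norm v"])
    (auto simp: norm_vector_scalar_mult vec_eq_iff algebra_simps)

lemma holo_on_imp_continuous_on: "holo_on \<Omega> f \<Longrightarrow> continuous_on \<Omega> f"
  unfolding holo_on_def
  by (metis has_derivative_continuous continuous_at_imp_continuous_on)

text \<open>Being 0 outside \<Omega>, \<open>f\<close> is a function continuous on an open set
  multiplied by the indicator of that set.\<close>

lemma holo_on_borel_measurable: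
  assumes "open \<Omega>" "holo_on \<Omega> f" "\<And>z. z \<notin> \<Omega> \<Longrightarrow> f z = 0"
  shows "f \<in> borel_measurable lebesgue"
proof -
  have "(\<lambda>z. indicator \<Omega> z *\<^sub>R f z) \<in> borel_measurable borel"
    using assms by (intro borel_measurable_continuous_on_indicator holo_on_imp_continuous_on) auto
  moreover have "(\<lambda>z. indicator \<Omega> z *\<^sub>R f z) = f"
    using assms(3) by (auto simp: indicator_def)
  ultimately show ?thesis
    by (simp add: measurable_completion)
qed

lemma holo_on_add:
  assumes "holo_on \<Omega> f" "holo_on \<Omega> g"
  shows "holo_on \<Omega> (\<lambda>z. f z + g z)"
  unfolding holo_on_def
proof
  fix z assume "z \<in> \<Omega>"
  then obtain D E where "(f has_derivative D) (at z)" "\<forall>c v. D (c *s v) = c * D v"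
      "(g has_derivative E) (at z)" "\<forall>c v. E (c *s v) = c * E v"
    using assms unfolding holo_on_def by blast
  then show "\<exists>D. ((\<lambda>z. f z + g z) has_derivative D) (at z) \<and> (\<forall>c v. D (c *s v) = c * D v)"
    by (intro exI[of _ "\<lambda>v. D v + E v"]) (auto intro!: has_derivative_add simp: distrib_left)
qed

lemma holo_on_mult:
  assumes "holo_on \<Omega> f"
  shows "holo_on \<Omega> (\<lambda>z. a * f z)"
  unfolding holo_on_def
proof
  fix z assume "z \<in> \<Omega>"
  then obtain D where "(f has_derivative D) (at z)" "\<forall>c v. D (c *s v) = c * D v"
    using assms unfolding holo_on_def by blast
  then show "\<exists>D. ((\<lambda>z. a * f z) has_derivative D) (at z) \<and> (\<forall>c v. D (c *s v) = c * D v)"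
    by (intro exI[of _ "\<lambda>v. a * D v"]) (auto intro!: has_derivative_mult_right)
qed

text \<open>Restricting to the complex line through \<open>z\<close> in direction \<open>v\<close> reduces this to the
  one-variable Cauchy inequality.\<close>

lemma holo_derivative_norm_le:
  fixes f :: "complex ^ 'n \<Rightarrow> complex"
  assumes holo: "holo_on \<Omega> f" and sub: "cball z s \<subseteq> \<Omega>" and s: "0 < s"
    and B: "\<And>w. w \<in> cball z s \<Longrightarrow> norm (f w) \<le> B"
    and D: "(f has_derivative D) (at z)" "\<And>c v. D (c *s v) = c * D v"
  shows "norm (D v) \<le> B / s * norm v"
proof (cases "v = 0")
  case True
  have "D 0 = 0" using D(2)[of 0 0] by simp
  then show ?thesis using True by simp
next
  case False
  define \<phi> where "\<phi> t = f (z + t *s v)" for t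
  \<comment> \<open>The disc of radius \<open>r\<close> is mapped into \<open>cball z s\<close>, and
    the one-variable bound \<open>B / r\<close> becomes \<open>B / s * norm v\<close>.\<close>
  define r where "r = s / norm v"
  have r: "r > 0" using False s by (simp add: r_def)
  have der: "(\<phi> has_field_derivative E v) (at t)"
    if "(f has_derivative E) (at (z + t *s v))" "\<And>c v. E (c *s v) = c * E v" for t E
  proof -
    have "((\<lambda>t. z + t *s v) has_derivative (\<lambda>t. t *s v)) (at t)"
      by (auto intro!: derivative_eq_intros bounded_linear_imp_has_derivative
          vector_scalar_mult_bounded_linear)
    from diff_chain_at[OF this that(1)] have "(\<phi> has_derivative (\<lambda>t. E (t *s v))) (at t)"
      by (simp add: \<phi>_def[abs_def] o_def)
    then show ?thesis
      by (simp add: has_field_derivative_def that(2) mult_commute_abs)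
  qed
  have inside: "z + t *s v \<in> cball z s" if "t \<in> cball 0 r" for t
  proof -
    have "norm t * norm v \<le> r * norm v"
      using that by (intro mult_right_mono) auto
    then show ?thesis
      using False by (simp add: dist_norm norm_vector_scalar_mult r_def)
  qed
  have "\<exists>E. (\<phi> has_field_derivative E) (at t)" if "t \<in> cball 0 r" for t
    using der inside[OF that] sub holo unfolding holo_on_def by blast
  then have hol: "\<phi> holomorphic_on cball 0 r"
    by (meson field_differentiable_at_within field_differentiable_def holomorphic_on_def)
  have "norm ((deriv ^^ 1) \<phi> 0) \<le> fact 1 * B / r ^ 1"
  proof (rule Cauchy_inequality)
    show "\<phi> holomorphic_on ball 0 r"
      by (rule holomorphic_on_subset[OF hol ball_subset_cball])
    show "continuous_on (cball 0 r) \<phi>"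
      by (rule holomorphic_on_imp_continuous_on[OF hol])
    show "cmod (\<phi> t) \<le> B" if "cmod (0 - t) = r" for t
      using B[OF inside[of t]] that by (simp add: \<phi>_def)
  qed (rule r)
  moreover have "deriv \<phi> 0 = D v"
    using der[of D 0] D by (simp add: DERIV_imp_deriv)
  ultimately show ?thesis
    using False s by (simp add: r_def)
qed

text \<open>Cauchy estimates turn the local majorant \<open>M k\<close> of the functions into the
  majorant \<open>M k / s\<close> of their derivatives on a smaller ball. The series of derivatives
  then converges uniformly, termwise differentiation applies, and complex homogeneity passes to the
  sum.\<close>

lemma holo_on_suminf:
  fixes f :: "nat \<Rightarrow> complex ^ 'n \<Rightarrow> complex"
  assumes holo: "\<And>k. holo_on \<Omega> (f k)"
    and loc: "\<And>z. z \<in> \<Omega> \<Longrightarrow> \<exists>r>0. cball z r \<subseteq> \<Omega> \<and>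
      (\<exists>M. summable M \<and> (\<forall>k. \<forall>w\<in>cball z r. norm (f k w) \<le> M k))"
  shows "holo_on \<Omega> (\<lambda>z. \<Sum>k. f k z)"
  unfolding holo_on_def
proof
  fix z assume "z \<in> \<Omega>"
  from loc[OF this] obtain r M where r: "r > 0" "cball z r \<subseteq> \<Omega>" and M: "summable M"
    and fM: "\<And>k w. w \<in> cball z r \<Longrightarrow> norm (f k w) \<le> M k"
    by blast
  have M0: "M k \<ge> 0" for k
    using fM[of z k] r by (metis centre_in_cball less_eq_real_def norm_ge_zero order_trans)
  \<comment> \<open>With half the radius, closed balls of radius \<open>s\<close> about points of
    \<open>S\<close> stay inside \<open>cball z r\<close>, where \<open>M\<close> is valid.\<close>
  define s where "s = r / 2"
  have s: "s > 0" using r by (simp add: s_def)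
  define S where "S = ball z s"
  have S: "z \<in> S" "convex S" "open S" using s by (auto simp: S_def)
  have near: "cball w s \<subseteq> cball z r" if "w \<in> S" for w
    using that by (simp add: S_def s_def cball_subset_cball_iff dist_commute)
  then have "w \<in> \<Omega>" if "w \<in> S" for w
    using that r(2) s centre_in_cball[of w s] by fastforce
  then have "\<forall>k. \<forall>w\<in>S. \<exists>D. (f k has_derivative D) (at w) \<and> (\<forall>c v. D (c *s v) = c * D v)"
    using holo unfolding holo_on_def by blast
  then obtain D where D: "\<And>k w. w \<in> S \<Longrightarrow> (f k has_derivative D k w) (at w)"
      "\<And>k w c v. w \<in> S \<Longrightarrow> D k w (c *s v) = c * D k w v"
    by metis
  have Dle: "norm (D k w v) \<le> M k / s * norm v" if "w \<in> S" for k w v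
    by (rule holo_derivative_norm_le[OF holo _ s _ D(1)[OF that] D(2)[OF that]])
      (use near[OF that] r fM in auto)
  define G where "G w v = (\<Sum>k. D k w v)" for w v
  have sumM: "summable (\<lambda>k. M k / s * c)" for c
    using M by (intro summable_mult2 summable_divide)
  have sumD: "summable (\<lambda>k. D k w v)" if "w \<in> S" for w v
    by (rule summable_comparison_test'[OF sumM[of "norm v"]]) (rule Dle[OF that])
  have "\<exists>g. \<forall>x\<in>S. (\<lambda>n. f n x) sums (g x) \<and> (g has_derivative G x) (at x within S)"
  proof (rule has_derivative_series[OF S(2)])
    show "(f n has_derivative D n x) (at x within S)" if "x \<in> S" for n x
      using D(1)[OF that] by (rule has_derivative_at_withinI)
    show "z \<in> S" by fact
    show "(\<lambda>n. f n z) sums (\<Sum>n. f n z)"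
      by (intro summable_sums summable_comparison_test'[OF M]) (use fM r in auto)
    \<comment> \<open>Uniform convergence: a tail of the series of derivatives is at most the tail
      of \<open>M\<close> times \<open>norm h / s\<close>, independently of
      \<open>x\<close>.\<close>
    fix e :: real assume e: "e > 0"
    have "(\<lambda>n. \<Sum>k. M (k + n)) \<longlonglongrightarrow> 0"
      by (rule suminf_exist_split2[OF M])
    then have "\<forall>\<^sub>F n in sequentially. (\<Sum>k. M (k + n)) < e * s"
      using e s by (intro order_tendstoD) auto
    then show "\<forall>\<^sub>F n in sequentially. \<forall>x\<in>S. \<forall>h. norm ((\<Sum>i<n. D i x h) - G x h) \<le> e * norm h"
    proof (rule eventually_mono, intro ballI allI)
      fix n x and h :: "complex ^ 'n" assume n: "(\<Sum>k. M (k + n)) < e * s" and x: "x \<in> S"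
      have sM: "summable (\<lambda>k. M (k + n) / s * norm h)"
        using sumM[of "norm h"] by (subst summable_iff_shift)
      have "norm ((\<Sum>i<n. D i x h) - G x h) = norm (\<Sum>k. D (k + n) x h)"
        unfolding G_def using suminf_split_initial_segment[OF sumD[OF x, of h], of n]
        by (simp add: norm_minus_commute)
      also have "\<dots> \<le> (\<Sum>k. M (k + n) / s * norm h)"
        by (rule norm_suminf_le[OF _ sM]) (rule Dle[OF x])
      also have "\<dots> = (\<Sum>k. M (k + n)) / s * norm h"
        using suminf_mult2[OF summable_ignore_initial_segment[OF M, of n], of "norm h / s"] by simp
      also have "\<dots> \<le> e * norm h"
        using n s by (intro mult_right_mono) (auto simp: pos_divide_le_eq)
      finally show "norm ((\<Sum>i<n. D i x h) - G x h) \<le> e * norm h" .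
    qed
  qed
  then obtain g where g: "\<And>x. x \<in> S \<Longrightarrow> (\<lambda>n. f n x) sums (g x)"
      "\<And>x. x \<in> S \<Longrightarrow> (g has_derivative G x) (at x within S)"
    by blast
  have "(g has_derivative G z) (at z)"
    using g(2)[OF S(1)] at_within_open[OF S(1,3)] by simp
  then have "((\<lambda>z. \<Sum>k. f k z) has_derivative G z) (at z)"
    by (rule has_derivative_transform_within_open[OF _ S(3,1)]) (use g(1) sums_unique in blast)
  moreover have "G z (c *s v) = c * G z v" for c v
    unfolding G_def using D(2)[OF S(1)] sumD[OF S(1), of v] by (simp add: suminf_mult)
  ultimately show "\<exists>D. ((\<lambda>z. \<Sum>k. f k z) has_derivative D) (at z) \<and> (\<forall>c v. D (c *s v) = c * D v)"
    by blast
qed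

section \<open>The function space and its metric\<close>

lemma OLp_belowD:
  assumes "f \<in> OLp_below \<Omega> q"
  shows "holo_on \<Omega> f" "\<And>z. z \<notin> \<Omega> \<Longrightarrow> f z = 0"
    "\<And>p. 1 \<le> p \<Longrightarrow> p < q \<Longrightarrow> Lp_int \<Omega> p f < \<infinity>"
  using assms by (auto simp: OLp_below_def)

lemma OLp_below_measurable:
  assumes "open \<Omega>" "f \<in> OLp_below \<Omega> q"
  shows "f \<in> borel_measurable lebesgue"
  using assms OLp_belowD(1,2)[OF assms(2)] by (intro holo_on_borel_measurable)

lemma OLp_below_add:
  assumes "open \<Omega>" "f \<in> OLp_below \<Omega> q" "g \<in> OLp_below \<Omega> q"
  shows "(\<lambda>z. f z + g z) \<in> OLp_below \<Omega> q"
  unfolding OLp_below_def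
proof (intro CollectI conjI allI impI)
  show "holo_on \<Omega> (\<lambda>z. f z + g z)"
    using assms by (intro holo_on_add OLp_belowD)
  show "f z + g z = 0" if "z \<notin> \<Omega>" for z
    using OLp_belowD(2)[OF assms(2) that] OLp_belowD(2)[OF assms(3) that] by simp
  show "Lp_int \<Omega> p (\<lambda>z. f z + g z) < \<infinity>" if "1 \<le> p \<and> p < q" for p
    using assms that
    by (intro Lp_int_add_finite OLp_below_measurable[OF assms(1)] OLp_belowD(3)) auto
qed

lemma OLp_below_mult:
  assumes "open \<Omega>" "f \<in> OLp_below \<Omega> q"
  shows "(\<lambda>z. c * f z) \<in> OLp_below \<Omega> q"
  unfolding OLp_below_def
proof (intro CollectI conjI allI impI)
  show "holo_on \<Omega> (\<lambda>z. c * f z)"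
    using assms by (intro holo_on_mult OLp_belowD)
  show "c * f z = 0" if "z \<notin> \<Omega>" for z
    using OLp_belowD(2)[OF assms(2) that] by simp
  show "Lp_int \<Omega> p (\<lambda>z. c * f z) < \<infinity>" if "1 \<le> p \<and> p < q" for p
    using assms that OLp_belowD(3)[OF assms(2), of p]
    by (subst Lp_int_mult) (auto simp: OLp_below_measurable ennreal_mult_less_top)
qed

lemma OLp_below_diff:
  assumes "open \<Omega>" "f \<in> OLp_below \<Omega> q" "g \<in> OLp_below \<Omega> q"
  shows "f - g \<in> OLp_below \<Omega> q"
  using OLp_below_add[OF assms(1,2) OLp_below_mult[OF assms(1,3), of "-1"]]
  by (simp add: fun_diff_def)

lemma Lp_int_subset_finite:
  assumes "f \<in> OLp_below \<Omega> q" "A \<subseteq> \<Omega>" "1 \<le> p" "p < q"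
  shows "Lp_int A p f < \<infinity>"
  using Lp_int_mono[of p A \<Omega> f f] OLp_belowD(3)[OF assms(1), of p] assms
  by (auto intro: order_le_less_trans)

text \<open>The difference vanishes almost everywhere. Its nonzero set in \<Omega> is open by
  continuity, and a negligible open set is empty. Outside \<Omega> both functions are 0 by
  normalisation.\<close>

lemma OLp_below_eqI:
  assumes \<Omega>: "open \<Omega>" and X: "f \<in> OLp_below \<Omega> q" "g \<in> OLp_below \<Omega> q"
    and p: "1 \<le> p" "p < q" and zero: "Lp_norm \<Omega> p (f - g) = 0"
  shows "f = g"
proof -
  define h where "h = f - g"
  have h: "h \<in> OLp_below \<Omega> q"
    unfolding h_def by (rule OLp_below_diff[OF \<Omega> X])
  note [measurable] = OLp_below_measurable[OF \<Omega> h]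
  have "Lp_int \<Omega> p h = 0"
    using Lp_int_eq_Lp_norm_powr[of p \<Omega> h] OLp_belowD(3)[OF h p] zero p by (simp add: h_def)
  moreover have "\<Omega> \<in> sets lebesgue"
    using \<Omega> by simp
  ultimately have "AE z in lebesgue. \<not> (z \<in> \<Omega> \<and> h z \<noteq> 0)"
    unfolding Lp_int_def
    by (subst (asm) nn_integral_0_iff_AE) (auto simp: indicator_def elim!: eventually_mono split: if_splits)
  then have neg: "negligible {z \<in> \<Omega>. h z \<noteq> 0}"
    by (simp add: completion.AE_iff_null_sets negligible_iff_null_sets)
  have "open (\<Omega> \<inter> h -` (- {0}))"
    using holo_on_imp_continuous_on[OF OLp_belowD(1)[OF h]] \<Omega>
    by (intro continuous_open_preimage) auto
  moreover have "\<Omega> \<inter> h -` (- {0}) = {z \<in> \<Omega>. h z \<noteq> 0}" by auto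
  ultimately have "{z \<in> \<Omega>. h z \<noteq> 0} = {}"
    using open_not_negligible neg by metis
  then have "h z = 0" for z
    using OLp_belowD(2)[OF h, of z] by auto
  then show ?thesis
    by (auto simp: h_def fun_eq_iff)
qed

lemma divide_one_plus_mono:
  fixes x y :: real
  assumes "0 \<le> x" "x \<le> y"
  shows "x / (1 + x) \<le> y / (1 + y)"
  using assms by (simp add: field_simps)

text \<open>Carries the triangle inequality of the individual norms over to the summands of
  \<open>OLp_dist\<close>.\<close>

lemma divide_one_plus_subadditive:
  fixes x y z :: real
  assumes "0 \<le> x" "0 \<le> y" "0 \<le> z" "x \<le> y + z"
  shows "x / (1 + x) \<le> y / (1 + y) + z / (1 + z)"
proof -
  have "x / (1 + x) \<le> (y + z) / (1 + (y + z))"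
    using assms by (intro divide_one_plus_mono)
  also have "\<dots> = y / (1 + (y + z)) + z / (1 + (y + z))"
    by (simp add: add_divide_distrib)
  also have "\<dots> \<le> y / (1 + y) + z / (1 + z)"
    using assms by (intro add_mono divide_left_mono) auto
  finally show ?thesis .
qed

lemma summable_half_power: "summable (\<lambda>k. (1/2) ^ Suc k :: real)"
  by (intro summable_Suc_iff[THEN iffD2] summable_geometric) auto

lemma summable_half_power_bounded:
  fixes x :: "nat \<Rightarrow> real"
  assumes "\<And>j. 0 \<le> x j"
  shows "summable (\<lambda>j. (1/2) ^ Suc j * (x j / (1 + x j)))"
proof (rule summable_comparison_test')
  show "summable (\<lambda>j. (1/2) ^ Suc j :: real)"
    by (rule summable_half_power)
  show "norm ((1/2) ^ Suc j * (x j / (1 + x j))) \<le> (1/2) ^ Suc j" for j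
    using assms[of j] mult_left_mono[of "x j / (1 + x j)" 1 "(1/2) ^ Suc j"]
    by (simp add: divide_le_eq_1 abs_mult)
qed

text \<open>Tannery's theorem with majorant \<open>(1/2) ^ Suc j\<close>, along the values 1/(n+1)
  of \<open>t\<close>. With \<open>M j\<close> the norms of one dominating function, it turns a
  small factor into a small distance.\<close>

lemma suminf_half_power_small:
  fixes M :: "nat \<Rightarrow> real"
  assumes M: "\<And>j. 0 \<le> M j" and "0 < e"
  obtains t where "0 < t" "(\<Sum>j. (1/2) ^ Suc j * (t * M j / (1 + t * M j))) < e"
proof -
  define a where "a j n = (1/2) ^ Suc j * (inverse (real (Suc n)) * M j / (1 + inverse (real (Suc n)) * M j))" for j n
  have "(\<lambda>n. \<Sum>j. a j n) \<longlonglongrightarrow> (\<Sum>j. (1/2) ^ Suc j * (0 * M j / (1 + 0 * M j)))"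
  proof (rule conjunct2[OF conjunct2[OF tannerys_theorem[where M="\<lambda>j. (1/2) ^ Suc j"]]])
    show "(\<lambda>n. a j n) \<longlonglongrightarrow> (1/2) ^ Suc j * (0 * M j / (1 + 0 * M j))" for j
      unfolding a_def by (intro tendsto_intros LIMSEQ_inverse_real_of_nat) auto
    have "norm (a j n) \<le> (1/2) ^ Suc j" for j n
    proof -
      define x where "x = inverse (real (Suc n)) * M j"
      have "x \<ge> 0" using M by (simp add: x_def)
      then show ?thesis
        using mult_left_mono[of "x / (1 + x)" 1 "(1/2) ^ Suc j"]
        unfolding a_def x_def[symmetric] by (simp add: divide_le_eq_1 abs_mult)
    qed
    then show "\<forall>\<^sub>F (j, n) in sequentially \<times>\<^sub>F sequentially. norm (a j n) \<le> (1/2) ^ Suc j"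
      by (intro always_eventually) auto
    show "summable (\<lambda>j. (1/2) ^ Suc j :: real)"
      by (rule summable_half_power)
  qed auto
  then have "\<forall>\<^sub>F n in sequentially. (\<Sum>j. a j n) < e"
    using \<open>0 < e\<close> by (intro order_tendstoD) auto
  then obtain n where "(\<Sum>j. a j n) < e"
    using eventually_happens' sequentially_bot by blast
  then show thesis
    using that[of "inverse (real (Suc n))"] by (simp add: a_def)
qed

lemma OLp_dist_summable:
  "summable (\<lambda>j. (1/2) ^ Suc j *
     (Lp_norm \<Omega> (pexp q (Suc j)) f / (1 + Lp_norm \<Omega> (pexp q (Suc j)) f)))"
  by (rule summable_half_power_bounded[OF Lp_norm_nonneg])

lemma Metric_space_OLp:
  assumes \<Omega>: "open \<Omega>" and q: "1 < q"
  shows "Metric_space (OLp_below \<Omega> q) (OLp_dist \<Omega> q)"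
proof
  fix f g h
  show "0 \<le> OLp_dist \<Omega> q f g"
    unfolding OLp_dist_def
    by (intro suminf_nonneg OLp_dist_summable) (simp add: Lp_norm_nonneg)
  have "Lp_norm \<Omega> p (f - g) = Lp_norm \<Omega> p (g - f)" for p
    by (rule Lp_norm_cong) (simp add: norm_minus_commute)
  then show "OLp_dist \<Omega> q f g = OLp_dist \<Omega> q g f"
    by (simp add: OLp_dist_def)
  assume X: "f \<in> OLp_below \<Omega> q" "g \<in> OLp_below \<Omega> q"
  show "OLp_dist \<Omega> q f g = 0 \<longleftrightarrow> f = g"
  proof
    assume "OLp_dist \<Omega> q f g = 0"
    \<comment> \<open>One vanishing norm already forces equality, so the first summand is
      enough.\<close>
    then have "(1/2) ^ Suc 0 * (Lp_norm \<Omega> (pexp q (Suc 0)) (f - g)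
        / (1 + Lp_norm \<Omega> (pexp q (Suc 0)) (f - g))) = 0"
      unfolding OLp_dist_def
      by (subst (asm) suminf_eq_zero_iff[OF OLp_dist_summable]) (auto simp: Lp_norm_nonneg)
    then have "Lp_norm \<Omega> (pexp q (Suc 0)) (f - g) = 0"
      using Lp_norm_nonneg[of \<Omega> "pexp q (Suc 0)" "f - g"] by auto
    then show "f = g"
      using OLp_below_eqI[OF \<Omega> X, of "pexp q (Suc 0)"] pexp_bounds[OF q, of 0] by simp
  next
    assume "f = g"
    then show "OLp_dist \<Omega> q f g = 0"
      using pexp_bounds[OF q] by (simp add: OLp_dist_def Lp_norm_def Lp_int_def)
  qed
  assume Y: "h \<in> OLp_below \<Omega> q"
  have tri: "Lp_norm \<Omega> (pexp q (Suc j)) (f - h)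
      \<le> Lp_norm \<Omega> (pexp q (Suc j)) (f - g) + Lp_norm \<Omega> (pexp q (Suc j)) (g - h)" for j
  proof -
    note fg = OLp_below_diff[OF \<Omega> X] and gh = OLp_below_diff[OF \<Omega> X(2) Y]
    have "Lp_norm \<Omega> (pexp q (Suc j)) (\<lambda>z. (f - g) z + (g - h) z)
        \<le> Lp_norm \<Omega> (pexp q (Suc j)) (f - g) + Lp_norm \<Omega> (pexp q (Suc j)) (g - h)"
      using \<Omega> pexp_bounds[OF q, of j]
      by (intro Lp_norm_triangle OLp_below_measurable[OF \<Omega> fg] OLp_below_measurable[OF \<Omega> gh]
          OLp_belowD(3)[OF fg] OLp_belowD(3)[OF gh]) auto
    then show ?thesis by (simp add: fun_diff_def)
  qed
  have "OLp_dist \<Omega> q f h \<le> (\<Sum>j.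
      (1/2) ^ Suc j * (Lp_norm \<Omega> (pexp q (Suc j)) (f - g) / (1 + Lp_norm \<Omega> (pexp q (Suc j)) (f - g)))
    + (1/2) ^ Suc j * (Lp_norm \<Omega> (pexp q (Suc j)) (g - h) / (1 + Lp_norm \<Omega> (pexp q (Suc j)) (g - h))))"
    unfolding OLp_dist_def
  proof (intro suminf_le summable_add OLp_dist_summable)
    fix j
    show "(1/2) ^ Suc j * (Lp_norm \<Omega> (pexp q (Suc j)) (f - h) / (1 + Lp_norm \<Omega> (pexp q (Suc j)) (f - h)))
      \<le> (1/2) ^ Suc j * (Lp_norm \<Omega> (pexp q (Suc j)) (f - g) / (1 + Lp_norm \<Omega> (pexp q (Suc j)) (f - g)))
      + (1/2) ^ Suc j * (Lp_norm \<Omega> (pexp q (Suc j)) (g - h) / (1 + Lp_norm \<Omega> (pexp q (Suc j)) (g - h)))"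
      unfolding distrib_left[symmetric]
      by (intro mult_left_mono divide_one_plus_subadditive tri Lp_norm_nonneg) simp
  qed
  also have "\<dots> = OLp_dist \<Omega> q f g + OLp_dist \<Omega> q g h"
    unfolding OLp_dist_def by (intro suminf_add[symmetric] OLp_dist_summable)
  finally show "OLp_dist \<Omega> q f h \<le> OLp_dist \<Omega> q f g + OLp_dist \<Omega> q g h" .
qed

section \<open>Singularity as a countable family of open conditions\<close>

text \<open>A single summand is at most the whole series and increases with the norm, so \<delta>
  can be the value of the \<open>j\<close>-th summand at norm \<open>e\<close>.\<close>

lemma Lp_norm_small_of_OLp_dist:
  assumes "0 < e"
  obtains \<delta> where "0 < \<delta>" "\<And>f g. OLp_dist \<Omega> q f g < \<delta> \<Longrightarrow> Lp_norm \<Omega> (pexp q (Suc j)) (f - g) < e"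
proof
  show "0 < (1/2) ^ Suc j * (e / (1 + e))" using assms by simp
  fix f g assume less: "OLp_dist \<Omega> q f g < (1/2) ^ Suc j * (e / (1 + e))"
  show "Lp_norm \<Omega> (pexp q (Suc j)) (f - g) < e"
  proof (rule ccontr)
    assume "\<not> Lp_norm \<Omega> (pexp q (Suc j)) (f - g) < e"
    then have "(1/2) ^ Suc j * (e / (1 + e)) \<le> (1/2) ^ Suc j *
        (Lp_norm \<Omega> (pexp q (Suc j)) (f - g) / (1 + Lp_norm \<Omega> (pexp q (Suc j)) (f - g)))"
      using assms by (intro mult_left_mono divide_one_plus_mono) auto
    also have "\<dots> \<le> OLp_dist \<Omega> q f g"
      unfolding OLp_dist_def
      using sum_le_suminf[OF OLp_dist_summable, of "{j}" \<Omega> q "f - g"] by (simp add: Lp_norm_nonneg)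
    finally show False using less by simp
  qed
qed

text \<open>If the norm of \<open>g\<close> over \<open>A\<close> exceeds \<open>N\<close> for some
  \<open>j\<close>, the triangle inequality for that exponent preserves this for all
  \<open>h\<close> whose norm distance from \<open>g\<close> is less than the excess.\<close>

lemma openin_OLp_Lp_norm_greater:
  assumes \<Omega>: "open \<Omega>" and q: "1 < q" and A: "A \<in> sets lebesgue" "A \<subseteq> \<Omega>"
  shows "openin (OLp_topology \<Omega> q) {g \<in> OLp_below \<Omega> q. \<exists>j. N < Lp_norm A (pexp q (Suc j)) g}"
proof -
  interpret Metric_space "OLp_below \<Omega> q" "OLp_dist \<Omega> q"
    by (rule Metric_space_OLp[OF \<Omega> q])
  show ?thesis
    unfolding OLp_topology_def openin_mtopology
  proof (intro conjI allI impI)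
    fix g assume "g \<in> {g \<in> OLp_below \<Omega> q. \<exists>j. N < Lp_norm A (pexp q (Suc j)) g}"
    then obtain j where g: "g \<in> OLp_below \<Omega> q" and j: "N < Lp_norm A (pexp q (Suc j)) g"
      by blast
    define p where "p = pexp q (Suc j)"
    have p: "1 < p" "p < q" using pexp_bounds[OF q] by (auto simp: p_def)
    obtain \<delta> where \<delta>: "0 < \<delta>"
      "\<And>f h. OLp_dist \<Omega> q f h < \<delta> \<Longrightarrow> Lp_norm \<Omega> p (f - h) < Lp_norm A p g - N"
      using Lp_norm_small_of_OLp_dist[of "Lp_norm A p g - N" \<Omega> q j] j unfolding p_def by auto
    have "N < Lp_norm A p h" if h: "h \<in> OLp_below \<Omega> q" and d: "OLp_dist \<Omega> q g h < \<delta>" for h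
    proof -
      note gh = OLp_below_diff[OF \<Omega> g h]
      have "Lp_norm A p (\<lambda>z. (g - h) z + h z) \<le> Lp_norm A p (g - h) + Lp_norm A p h"
        using p A by (intro Lp_norm_triangle OLp_below_measurable[OF \<Omega> gh] OLp_below_measurable[OF \<Omega> h]
          Lp_int_subset_finite[OF gh] Lp_int_subset_finite[OF h]) auto
      moreover have "Lp_norm A p (g - h) \<le> Lp_norm \<Omega> p (g - h)"
        using p A OLp_belowD(3)[OF gh, of p] by (intro Lp_norm_mono) auto
      ultimately show ?thesis
        using \<delta>(2)[OF d] by simp
    qed
    then show "\<exists>r>0. mball g r \<subseteq> {g \<in> OLp_below \<Omega> q. \<exists>j. N < Lp_norm A (pexp q (Suc j)) g}"
      using \<delta>(1) unfolding p_def by (auto simp: mball_def)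
  qed auto
qed

text \<open>The negated Fatou criterion; boundedness of \<Omega> supplies the finite measure of
  \<open>A\<close>. Natural numbers as bounds keep the family of conditions countable.\<close>

lemma Lp_int_infinite_iff:
  assumes \<Omega>: "open \<Omega>" "bounded \<Omega>" and q: "1 < q" and A: "A \<in> sets lebesgue" "A \<subseteq> \<Omega>"
    and g: "g \<in> OLp_below \<Omega> q"
  shows "Lp_int A q g = \<infinity> \<longleftrightarrow> (\<forall>N::nat. \<exists>j. real N < Lp_norm A (pexp q (Suc j)) g)"
proof -
  have "emeasure lebesgue A \<le> emeasure lebesgue \<Omega>"
    using \<Omega> A by (intro emeasure_mono) auto
  also have "\<dots> < \<infinity>"
    using emeasure_bounded_finite[OF \<Omega>(2)] \<Omega> by simp
  finally have "Lp_int A q g < \<infinity> \<longleftrightarrow> (\<exists>N::nat. \<forall>j. Lp_norm A (pexp q (Suc j)) g \<le> real N)"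
    by (intro Lp_int_finite_iff_Lp_norms_bounded OLp_below_measurable[OF \<Omega>(1) g] A(1) q
        Lp_int_subset_finite[OF g A(2)])
  then show ?thesis
    by (metis infinity_ennreal_def less_top linorder_not_less)
qed

section \<open>Construction of singular functions near a given one\<close>

text \<open>One \<open>c\<close> serves all exponents up to \<open>r\<close>:
  \<open>c \<le> 1\<close> gives \<open>c powr p \<le> c\<close>, and \<open>L\<close> bounds the
  integrals for all these exponents. Adding \<open>B\<close> in the denominator handles the compact
  set as well.\<close>

lemma OLp_below_scale_small:
  assumes \<Omega>: "open \<Omega>" "bounded \<Omega>" and f: "f \<in> OLp_below \<Omega> q"
    and K: "compact K" "K \<subseteq> \<Omega>" and r: "1 \<le> r" "r < q" and e: "0 < e"
  obtains c :: real where "0 < c" "\<And>z. z \<in> K \<Longrightarrow> c * norm (f z) \<le> e"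
    "\<And>p. 1 \<le> p \<Longrightarrow> p \<le> r \<Longrightarrow> Lp_int \<Omega> p (\<lambda>z. complex_of_real c * f z) \<le> ennreal e"
proof -
  have "bounded (f ` K)"
    using holo_on_imp_continuous_on[OF OLp_belowD(1)[OF f]] K
    by (intro compact_imp_bounded compact_continuous_image) (auto intro: continuous_on_subset)
  then obtain B where B: "B > 0" "\<And>z. z \<in> K \<Longrightarrow> norm (f z) \<le> B"
    by (auto simp: bounded_pos)
  have "emeasure lebesgue \<Omega> < \<infinity>"
    using emeasure_bounded_finite[OF \<Omega>(2)] \<Omega> by simp
  then obtain L where L: "0 \<le> L" "emeasure lebesgue \<Omega> + Lp_int \<Omega> r f = ennreal L"
    using OLp_belowD(3)[OF f r] by (cases "emeasure lebesgue \<Omega> + Lp_int \<Omega> r f") auto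
  define c where "c = min 1 (e / (B + L))"
  have c: "0 < c" "c \<le> 1" "c * (B + L) \<le> e"
    using B L e by (auto simp: c_def min_def)
  have cB: "c * B \<le> e" and cL: "c * L \<le> e"
    using c B(1) L(1) mult_nonneg_nonneg[of c L] mult_nonneg_nonneg[of c B]
    unfolding distrib_left by linarith+
  show thesis
  proof (rule that[of c])
    show "c * norm (f z) \<le> e" if "z \<in> K" for z
      using mult_left_mono[OF B(2)[OF that], of c] c cB by linarith
    fix p :: real assume p: "1 \<le> p" "p \<le> r"
    have "Lp_int \<Omega> p (\<lambda>z. complex_of_real c * f z) = ennreal (c powr p) * Lp_int \<Omega> p f"
      using \<Omega> c by (subst Lp_int_mult) (auto simp: OLp_below_measurable[OF \<Omega>(1) f])
    also have "\<dots> \<le> ennreal c * ennreal L"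
    proof (intro mult_mono ennreal_leI)
      show "c powr p \<le> c"
        using powr_mono'[of 1 p c] p c by simp
      show "Lp_int \<Omega> p f \<le> ennreal L"
        unfolding L(2)[symmetric] using p \<Omega>
        by (intro Lp_int_le_lower_exponent OLp_below_measurable[OF \<Omega>(1) f]) auto
    qed auto
    also have "\<dots> \<le> ennreal e"
      using c L cL by (simp add: ennreal_leI flip: ennreal_mult)
    finally show "Lp_int \<Omega> p (\<lambda>z. complex_of_real c * f z) \<le> ennreal e" .
  qed (rule c(1))
qed

lemma suminf_half_power: "(\<Sum>k. (1/2) ^ Suc k :: real) = 1"
  by (rule sums_unique[OF power_half_series, symmetric])

text \<open>Pointwise, the weighted mean is at most the supremum, whose \<open>p\<close>-th power is at most
  the sum of all \<open>p\<close>-th powers; this avoids an infinite version of Minkowski's inequality.\<close>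

lemma Lp_int_weighted_suminf_le:
  fixes f :: "nat \<Rightarrow> complex ^ 'n \<Rightarrow> complex"
  assumes meas: "\<And>k. f k \<in> borel_measurable lebesgue" "A \<in> sets lebesgue" and p: "0 < p"
  shows "Lp_int A p (\<lambda>z. complex_of_real (\<Sum>k. (1/2) ^ Suc k * norm (f k z))) \<le> (\<Sum>k. Lp_int A p (f k))"
proof -
  have ptw: "ennreal (norm (complex_of_real (\<Sum>k. (1/2) ^ Suc k * norm (f k z))) powr p)
      \<le> (\<Sum>k. ennreal (norm (f k z) powr p))" for z
  proof (cases "(\<Sum>k. ennreal (norm (f k z) powr p))")
    case (real s)
    have le: "norm (f k z) \<le> s powr (1/p)" for k
    proof -
      have "ennreal (norm (f k z) powr p) \<le> ennreal s"
        using sum_le_suminf[of "\<lambda>k. ennreal (norm (f k z) powr p)" "{k}"] real by simp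
      then have "norm (f k z) powr p \<le> s"
        using real by simp
      then have "(norm (f k z) powr p) powr (1/p) \<le> s powr (1/p)"
        using p by (intro powr_mono2) auto
      then show ?thesis using p by (simp add: powr_powr)
    qed
    have sm: "summable (\<lambda>k. (1/2) ^ Suc k * s powr (1/p))"
      by (intro summable_mult2 summable_half_power)
    have sf: "summable (\<lambda>k. (1/2) ^ Suc k * norm (f k z))"
      by (rule summable_comparison_test'[OF sm])
        (use le in \<open>auto simp: abs_mult simp del: power_Suc intro!: mult_left_mono\<close>)
    have "(\<Sum>k. (1/2) ^ Suc k * norm (f k z)) \<le> (\<Sum>k. (1/2) ^ Suc k * s powr (1/p))"
      by (intro suminf_le sm sf mult_left_mono le) auto
    also have "\<dots> = s powr (1/p)"
      using suminf_mult2[OF summable_half_power, of "s powr (1/p)"] by (simp only: suminf_half_power mult_1_left)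
    finally have F: "(\<Sum>k. (1/2) ^ Suc k * norm (f k z)) \<le> s powr (1/p)" .
    have F0: "0 \<le> (\<Sum>k. (1/2) ^ Suc k * norm (f k z))"
      by (intro suminf_nonneg sf) simp
    have "norm (complex_of_real (\<Sum>k. (1/2) ^ Suc k * norm (f k z))) powr p \<le> (s powr (1/p)) powr p"
      using F F0 p by (intro powr_mono2) (simp_all del: power_Suc)
    also have "\<dots> = s"
      using p real by (simp add: powr_powr)
    finally show ?thesis
      using real by (simp add: ennreal_leI)
  qed simp
  have "Lp_int A p (\<lambda>z. complex_of_real (\<Sum>k. (1/2) ^ Suc k * norm (f k z)))
      \<le> (\<integral>\<^sup>+ z. (\<Sum>k. ennreal (norm (f k z) powr p) * indicator A z) \<partial>lebesgue)"
    unfolding Lp_int_def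
  proof (intro nn_integral_mono)
    fix z
    show "ennreal (norm (complex_of_real (\<Sum>k. (1/2) ^ Suc k * norm (f k z))) powr p) * indicator A z
        \<le> (\<Sum>k. ennreal (norm (f k z) powr p) * indicator A z)"
      using ptw[of z] by (cases "z \<in> A") (simp_all del: power_Suc)
  qed
  also have "\<dots> = (\<Sum>k. Lp_int A p (f k))"
    unfolding Lp_int_def using meas by (subst nn_integral_suminf) auto
  finally show ?thesis .
qed

text \<open>Domination is only eventual because, in the application, the bound on the
  \<open>k\<close>-th term at exponent \<open>p\<close> holds once \<open>pexp q (Suc k)\<close> has
  reached \<open>p\<close>. The earlier terms are finite one by one.\<close>

lemma suminf_ennreal_finite:
  fixes a :: "nat \<Rightarrow> ennreal"
  assumes fin: "\<And>k. a k < \<infinity>" and "summable b" "\<forall>\<^sub>F k in sequentially. a k \<le> ennreal (b k)"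
    and b: "\<And>k. 0 \<le> b k"
  shows "(\<Sum>k. a k) < \<infinity>"
proof -
  have a: "a k = ennreal (enn2real (a k))" for k
    using fin[of k] by simp
  have "\<forall>\<^sub>F k in sequentially. norm (enn2real (a k)) \<le> b k"
    using assms(3) by eventually_elim (simp add: enn2real_leI b)
  then have "summable (\<lambda>k. enn2real (a k))"
    using \<open>summable b\<close> by (rule summable_comparison_test_ev)
  then have "(\<Sum>k. ennreal (enn2real (a k))) = ennreal (\<Sum>k. enn2real (a k))"
    by (intro suminf_ennreal2) auto
  then show ?thesis
    using a by simp
qed

lemma eventually_less_pexp:
  assumes "p < q"
  shows "\<forall>\<^sub>F k in sequentially. p \<le> pexp q (Suc k)"
  using order_tendstoD(1)[OF pexp_tendsto assms] by eventually_elim simp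

text \<open>The \<open>complete_space\<close> instance of bounded continuous functions requires a metric domain,
  which \<open>nat\<close> is not.\<close>

lemma completely_metrizable_space_bcontfun:
  "completely_metrizable_space (euclidean :: ('a::topological_space \<Rightarrow>\<^sub>C 'b::complete_space) topology)"
proof -
  have "convergent f" if "Cauchy f" for f :: "nat \<Rightarrow> 'a \<Rightarrow>\<^sub>C 'b"
  proof -
    have "uniformly_Cauchy_on UNIV (\<lambda>n. apply_bcontfun (f n))"
      using that unfolding Cauchy_def uniformly_Cauchy_on_def
      by (meson dist_fun_lt_imp_dist_val_lt)
    then obtain g where "uniform_limit UNIV (\<lambda>n. apply_bcontfun (f n)) g sequentially"
      using Cauchy_uniformly_convergent uniformly_convergent_on_def by blast
    then show ?thesis
      by (metis convergentI sequentially_bot uniform_limit_bcontfunE)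
  qed
  then have "complete (UNIV :: ('a \<Rightarrow>\<^sub>C 'b) set)"
    by (auto simp: complete_def convergent_def)
  then show ?thesis
    using Met_TC.completely_metrizable_space_mtopology by auto
qed

lemma exists_perturbation_infinite_Lp_int:
  fixes \<Omega> :: "(complex ^ 'n) set"
  assumes \<Omega>: "open \<Omega>" "bounded \<Omega>" and q: "1 < q" and g0: "g0 \<in> OLp_below \<Omega> q" and "0 < \<rho>"
    and A: "\<And>k::nat. A k \<in> sets lebesgue" "\<And>k. A k \<subseteq> \<Omega>"
    and bad: "\<And>k. \<exists>f \<in> OLp_below \<Omega> q. Lp_int (A k) q f = \<infinity>"
  shows "\<exists>h\<in>OLp_below \<Omega> q. OLp_dist \<Omega> q g0 h < \<rho> \<and> (\<forall>k. Lp_int (A k) q h = \<infinity>)"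
proof -
  obtain C :: "nat \<Rightarrow> (complex ^ 'n) set" where C: "\<And>n. compact (C n)" "\<And>n. C n \<subseteq> \<Omega>"
      and exhaust: "\<And>K. compact K \<Longrightarrow> K \<subseteq> \<Omega> \<Longrightarrow> \<exists>N. \<forall>n\<ge>N. K \<subseteq> C n"
    using open_Union_compact_subsets[OF \<Omega>(1)] by metis
  \<comment> \<open>The bounds \<open>(1/2) ^ k\<close> make the integrals summable at each fixed
    exponent. On \<open>C k\<close> the bound 1 is enough, as the weights of the series are
    summable.\<close>
  have "\<exists>f. f \<in> OLp_below \<Omega> q \<and> Lp_int (A k) q f = \<infinity> \<and> (\<forall>z\<in>C k. norm (f z) \<le> 1) \<and>
      (\<forall>p. 1 \<le> p \<longrightarrow> p \<le> pexp q (Suc k) \<longrightarrow> Lp_int \<Omega> p f \<le> ennreal ((1/2) ^ k))" for k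
  proof -
    obtain f where f: "f \<in> OLp_below \<Omega> q" "Lp_int (A k) q f = \<infinity>"
      using bad by blast
    have "1 \<le> pexp q (Suc k)" "pexp q (Suc k) < q"
      using pexp_bounds[OF q, of k] by auto
    then obtain c :: real where c: "0 < c" "\<And>z. z \<in> C k \<Longrightarrow> c * norm (f z) \<le> (1/2) ^ k"
      "\<And>p. 1 \<le> p \<Longrightarrow> p \<le> pexp q (Suc k) \<Longrightarrow> Lp_int \<Omega> p (\<lambda>z. complex_of_real c * f z) \<le> ennreal ((1/2) ^ k)"
      using OLp_below_scale_small[OF \<Omega> f(1) C(1,2), of "pexp q (Suc k)" "(1/2) ^ k" k] by auto
    have "Lp_int (A k) q (\<lambda>z. complex_of_real c * f z) = \<infinity>"
      using c f A by (subst Lp_int_mult) (auto simp: OLp_below_measurable[OF \<Omega>(1) f(1)] ennreal_mult_eq_top_iff)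
    moreover have "norm (complex_of_real c * f z) \<le> 1" if "z \<in> C k" for z
      using c(1) c(2)[OF that] power_le_one[of "1/2::real" k] by (simp add: norm_mult)
    ultimately show ?thesis
      using c(3) OLp_below_mult[OF \<Omega>(1) f(1), of "complex_of_real c"] by blast
  qed
  then obtain f where f: "\<And>k. f k \<in> OLp_below \<Omega> q" "\<And>k. Lp_int (A k) q (f k) = \<infinity>"
      "\<And>k z. z \<in> C k \<Longrightarrow> norm (f k z) \<le> 1"
      "\<And>k p. 1 \<le> p \<Longrightarrow> p \<le> pexp q (Suc k) \<Longrightarrow> Lp_int \<Omega> p (f k) \<le> ennreal ((1/2) ^ k)"
    by metis
  note fmeas [measurable] = OLp_below_measurable[OF \<Omega>(1) f(1)]
  \<comment> \<open>A common majorant: every perturbation below is bounded pointwise by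
    \<open>norm a\<close> times \<open>F\<close>. It is cast to complex values to fit
    \<open>Lp_int\<close>.\<close>
  define F where "F z = complex_of_real (\<Sum>k. (1/2) ^ Suc k * norm (f k z))" for z
  have Fmeas: "F \<in> borel_measurable lebesgue"
    unfolding F_def by measurable
  have Ffin: "Lp_int \<Omega> p F < \<infinity>" if p: "1 \<le> p" "p < q" for p
  proof -
    have "(\<Sum>k. Lp_int \<Omega> p (f k)) < \<infinity>"
    proof (rule suminf_ennreal_finite)
      show "Lp_int \<Omega> p (f k) < \<infinity>" for k
        using OLp_belowD(3)[OF f(1) p] .
      show "\<forall>\<^sub>F k in sequentially. Lp_int \<Omega> p (f k) \<le> ennreal ((1/2) ^ k)"
        using eventually_less_pexp[OF p(2)] by eventually_elim (rule f(4)[OF p(1)])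
    qed (auto intro: summable_geometric)
    then show ?thesis
      unfolding F_def using Lp_int_weighted_suminf_le[of f \<Omega> p] fmeas \<Omega> p
      by (auto intro: order_le_less_trans)
  qed
  have loc: "\<exists>r>0. cball z r \<subseteq> \<Omega> \<and> (\<exists>M. summable M \<and>
      (\<forall>k. \<forall>w\<in>cball z r. (1/2) ^ Suc k * norm (f k w) \<le> M k))" if z: "z \<in> \<Omega>" for z
  proof -
    obtain r where r: "r > 0" "cball z r \<subseteq> \<Omega>"
      using \<Omega>(1) z open_contains_cball by blast
    obtain N where N: "\<And>n. n \<ge> N \<Longrightarrow> cball z r \<subseteq> C n"
      using exhaust[OF compact_cball r(2)] by blast
    have "\<exists>B. \<forall>w\<in>cball z r. norm (f k w) \<le> B" for k
    proof -
      have "bounded (f k ` cball z r)"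
        using holo_on_imp_continuous_on[OF OLp_belowD(1)[OF f(1)]] r
        by (intro compact_imp_bounded compact_continuous_image) (auto intro: continuous_on_subset)
      then show ?thesis by (auto simp: bounded_iff)
    qed
    then obtain B where B: "\<And>k w. w \<in> cball z r \<Longrightarrow> norm (f k w) \<le> B k"
      by metis
    \<comment> \<open>All but finitely many of the sets \<open>C k\<close> contain the ball; for the
      remaining \<open>k\<close>, compactness provides \<open>B k\<close>.\<close>
    define M where "M k = (1/2) ^ Suc k * (if k < N then B k else 1)" for k
    have "\<forall>\<^sub>F k in sequentially. M k = (1/2) ^ Suc k"
      using eventually_ge_at_top[of N] by eventually_elim (simp add: M_def)
    then have "summable M"
      by (rule summable_cong[THEN iffD2, OF _ summable_half_power])
    moreover have "(1/2) ^ Suc k * norm (f k w) \<le> M k" if "w \<in> cball z r" for k w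
      unfolding M_def using B[OF that, of k] f(3)[of w k] N[of k] that
      by (intro mult_left_mono) (auto simp: subset_iff)
    ultimately show ?thesis
      using r by blast
  qed
  have sumf: "summable (\<lambda>k. (1/2) ^ Suc k * norm (f k z))" for z
  proof (cases "z \<in> \<Omega>")
    case True
    from loc[OF this] obtain r M where r: "r > 0" and M: "summable M"
      "\<And>k w. w \<in> cball z r \<Longrightarrow> (1/2) ^ Suc k * norm (f k w) \<le> M k"
      by blast
    show ?thesis
    proof (rule summable_comparison_test'[OF M(1)])
      show "norm ((1/2) ^ Suc k * norm (f k z)) \<le> M k" for k
        using M(2)[of z k] r by (simp add: abs_mult del: power_Suc)
    qed
  next
    case False
    then show ?thesis
      using OLp_belowD(2)[OF f(1)] by simp
  qed
  \<comment> \<open>Every function on the discrete space of naturals is continuous, so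
    \<open>nat \<Rightarrow>\<^sub>C real\<close> is the space of bounded real sequences with the
    supremum norm.\<close>
  define t where "t a k z = complex_of_real (apply_bcontfun a k * (1/2) ^ Suc k) * f k z"
    for a :: "nat \<Rightarrow>\<^sub>C real" and k z
  have tle: "norm (t a k z) \<le> norm a * ((1/2) ^ Suc k * norm (f k z))" for a k z
    using mult_right_mono[OF norm_bounded[of a k], of "(1/2) ^ Suc k * norm (f k z)"]
    by (simp add: t_def norm_mult abs_mult mult.assoc del: power_Suc of_real_mult)
  have tsum: "summable (\<lambda>k. t a k z)" for a z
    by (rule summable_comparison_test'[OF summable_mult[OF sumf]]) (rule tle)
  define H where "H a z = (\<Sum>k. t a k z)" for a z
  have Hle: "norm (H a z) \<le> norm (complex_of_real (norm a) * F z)" for a z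
  proof -
    have "norm (H a z) \<le> (\<Sum>k. norm a * ((1/2) ^ Suc k * norm (f k z)))"
      unfolding H_def by (intro norm_suminf_le tle summable_mult sumf)
    also have "\<dots> = norm a * (\<Sum>k. (1/2) ^ Suc k * norm (f k z))"
      by (intro suminf_mult sumf)
    also have "\<dots> = norm (complex_of_real (norm a) * F z)"
      unfolding F_def norm_mult norm_of_real
      by (subst (2) abs_of_nonneg) (auto intro!: suminf_nonneg sumf simp del: power_Suc)
    finally show ?thesis .
  qed
  have Hdiff: "H a z - H b z = H (a - b) z" for a b z
  proof -
    have "t (a - b) k z = t a k z - t b k z" for k
      by (simp add: t_def left_diff_distrib diff_divide_distrib)
    then show ?thesis
      unfolding H_def by (simp add: suminf_diff[OF tsum tsum])
  qed
  have Hholo: "holo_on \<Omega> (H a)" for a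
    unfolding H_def
  proof (rule holo_on_suminf)
    show "holo_on \<Omega> (t a k)" for k
      unfolding t_def using holo_on_mult[OF OLp_belowD(1)[OF f(1)]] .
    fix z assume "z \<in> \<Omega>"
    from loc[OF this] obtain r M where r: "r > 0" "cball z r \<subseteq> \<Omega>" and M: "summable M"
      "\<And>k w. w \<in> cball z r \<Longrightarrow> (1/2) ^ Suc k * norm (f k w) \<le> M k"
      by blast
    have "norm (t a k w) \<le> norm a * M k" if "w \<in> cball z r" for k w
      using tle[of a k w] mult_left_mono[OF M(2)[OF that, of k], of "norm a"] by simp
    then show "\<exists>r>0. cball z r \<subseteq> \<Omega> \<and> (\<exists>M. summable M \<and> (\<forall>k. \<forall>w\<in>cball z r. norm (t a k w) \<le> M k))"
      using r M(1) by (intro exI[of _ r] conjI exI[of _ "\<lambda>k. norm a * M k"] summable_mult) auto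
  qed
  have aFfin: "Lp_int \<Omega> p (\<lambda>z. complex_of_real (norm a) * F z) < \<infinity>"
    if "1 \<le> p" "p < q" for p and a :: "nat \<Rightarrow>\<^sub>C real"
    using Ffin[OF that] \<Omega> by (subst Lp_int_mult[OF Fmeas]) (auto simp: ennreal_mult_less_top)
  have HX: "H a \<in> OLp_below \<Omega> q" for a
    unfolding OLp_below_def
  proof (intro CollectI conjI allI impI Hholo)
    show "H a z = 0" if "z \<notin> \<Omega>" for z
      using OLp_belowD(2)[OF f(1) that] by (simp add: H_def t_def)
    show "Lp_int \<Omega> p (H a) < \<infinity>" if "1 \<le> p \<and> p < q" for p
      using Lp_int_mono[of p \<Omega> \<Omega> "H a", OF _ _ Hle] aFfin[of p a] that
      by (auto intro: order_le_less_trans)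
  qed
  have Hnorm: "Lp_norm S p (H a) \<le> norm a * Lp_norm \<Omega> p F" if "1 \<le> p" "p < q" "S \<subseteq> \<Omega>" for S p a
  proof -
    have "Lp_norm S p (H a) \<le> Lp_norm \<Omega> p (\<lambda>z. complex_of_real (norm a) * F z)"
      using that aFfin[of p a] by (intro Lp_norm_mono Hle) auto
    also have "\<dots> = norm a * Lp_norm \<Omega> p F"
      using that \<Omega> by (subst Lp_norm_mult[OF Fmeas]) auto
    finally show ?thesis .
  qed
  define G where "G a z = g0 z + H a z" for a z
  have GX: "G a \<in> OLp_below \<Omega> q" for a
    unfolding G_def by (rule OLp_below_add[OF \<Omega>(1) g0 HX])
  \<comment> \<open>By \<open>Lp_int_infinite_iff\<close>, the union of \<open>E k N\<close> over
    \<open>N\<close> consists of the parameters for which \<open>G a\<close> has finite integral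
    over \<open>A k\<close>.\<close>
  define E where "E k N = {a. \<forall>j. Lp_norm (A k) (pexp q (Suc j)) (G a) \<le> real N}" for k N
  have lip: "Lp_norm (A k) p (G a) \<le> Lp_norm (A k) p (G b) + norm (a - b) * Lp_norm \<Omega> p F"
    if p: "1 \<le> p" "p < q" for k p a b
  proof -
    have "G a = (\<lambda>z. G b z + H (a - b) z)"
      by (auto simp: G_def Hdiff[symmetric])
    then have "Lp_norm (A k) p (G a) \<le> Lp_norm (A k) p (G b) + Lp_norm (A k) p (H (a - b))"
      using p A \<Omega> Lp_norm_triangle[of "G b" "H (a - b)" "A k" p]
      by (simp add: OLp_below_measurable[OF _ GX] OLp_below_measurable[OF _ HX]
          Lp_int_subset_finite[OF GX] Lp_int_subset_finite[OF HX] flip: infinity_ennreal_def)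
    then show ?thesis
      using Hnorm[OF p A(2), of k "a - b"] by simp
  qed
  have closed: "closed (E k N)" for k N
  proof -
    have "continuous_on UNIV (\<lambda>a. Lp_norm (A k) (pexp q (Suc j)) (G a))" for j
    proof -
      have p: "1 \<le> pexp q (Suc j)" "pexp q (Suc j) < q"
        using pexp_bounds[OF q, of j] by auto
      \<comment> \<open>The Lipschitz constant may depend on \<open>j\<close>: \<open>E k N\<close>
        is an intersection of closed sets, one for each \<open>j\<close>.\<close>
      have "(Lp_norm \<Omega> (pexp q (Suc j)) F)-lipschitz_on UNIV (\<lambda>a. Lp_norm (A k) (pexp q (Suc j)) (G a))"
      proof (rule lipschitz_onI)
        fix a b
        show "dist (Lp_norm (A k) (pexp q (Suc j)) (G a)) (Lp_norm (A k) (pexp q (Suc j)) (G b))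
            \<le> Lp_norm \<Omega> (pexp q (Suc j)) F * dist a b"
          using lip[OF p, of k a b] lip[OF p, of k b a]
          by (simp add: dist_norm norm_minus_commute[of b a] mult.commute abs_le_iff)
      qed (rule Lp_norm_nonneg)
      then show ?thesis by (rule lipschitz_on_continuous_on)
    qed
    then show ?thesis
      unfolding E_def by (intro closed_Collect_all closed_Collect_le continuous_on_const)
  qed
  have nowhere: "interior (E k N) = {}" for k N
  proof (rule ccontr)
    assume "interior (E k N) \<noteq> {}"
    then obtain a s where s: "s > 0" "ball a s \<subseteq> E k N"
      by (auto simp: mem_interior)
    \<comment> \<open>Moving only the \<open>k\<close>-th coordinate, by half the radius, stays
      inside the ball and changes \<open>G a\<close> by a multiple of \<open>f k\<close>.\<close>
    have "(\<lambda>i. if i = k then s / 2 else 0) \<in> bcontfun"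
      by (rule bcontfun_normI[where b="s/2"]) (use s in auto)
    then obtain u where u: "apply_bcontfun u = (\<lambda>i. if i = k then s / 2 else 0)"
      by (metis Bcontfun_inverse)
    have nu: "norm u \<le> s / 2"
      by (rule norm_bound) (use u s in auto)
    have "a \<in> E k N" "a + u \<in> E k N"
      using s nu by (auto simp: dist_norm subset_iff)
    \<comment> \<open>The coefficient of \<open>f k\<close> in \<open>H u\<close>: the height of the
      bump times its weight in the series.\<close>
    define w where "w = s / 2 * (1/2) ^ Suc k"
    have w: "w > 0" using s by (simp add: w_def)
    have "t u i z = (if i = k then complex_of_real w * f k z else 0)" for i z
      by (simp add: t_def u w_def)
    then have "H u = (\<lambda>z. complex_of_real w * f k z)"
      using sums_unique[OF sums_single[of k "\<lambda>i. complex_of_real w * f k z" for z]]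
      by (auto simp: H_def fun_eq_iff)
    then have fk: "complex_of_real w * f k z = G (a + u) z + (- 1) * G a z" for z
      using Hdiff[of "a + u" z a] by (simp add: G_def)
    \<comment> \<open>Both \<open>G (a + u)\<close> and \<open>G a\<close> have norms at most
      \<open>N\<close>, so their difference has norms at most \<open>2 * N\<close> for every
      \<open>j\<close>, which contradicts the infinite integral of \<open>f k\<close>.\<close>
    have "Lp_norm (A k) (pexp q (Suc j)) (\<lambda>z. complex_of_real w * f k z) \<le> real (2 * N)" for j
    proof -
      have p: "1 \<le> pexp q (Suc j)" "pexp q (Suc j) < q"
        using pexp_bounds[OF q, of j] by auto
      note m = OLp_below_mult[OF \<Omega>(1) GX, of "-1" a]
      have "Lp_norm (A k) (pexp q (Suc j)) (\<lambda>z. complex_of_real w * f k z)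
          \<le> Lp_norm (A k) (pexp q (Suc j)) (G (a + u)) + Lp_norm (A k) (pexp q (Suc j)) (\<lambda>z. (- 1) * G a z)"
        unfolding fk using p
        by (intro Lp_norm_triangle OLp_below_measurable[OF \<Omega>(1) GX] OLp_below_measurable[OF \<Omega>(1) m]
            Lp_int_subset_finite[OF GX A(2)] Lp_int_subset_finite[OF m A(2)] A(1))
      also have "Lp_norm (A k) (pexp q (Suc j)) (\<lambda>z. (- 1) * G a z) = Lp_norm (A k) (pexp q (Suc j)) (G a)"
        by (rule Lp_norm_cong) simp
      finally show ?thesis
        using \<open>a \<in> E k N\<close> \<open>a + u \<in> E k N\<close> unfolding E_def by (smt (verit) mem_Collect_eq mult_2 of_nat_add)
    qed
    then have "Lp_int (A k) q (\<lambda>z. complex_of_real w * f k z) \<noteq> \<infinity>"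
      using Lp_int_infinite_iff[OF \<Omega> q A OLp_below_mult[OF \<Omega>(1) f(1)[of k], of "complex_of_real w"], of k]
      by (metis linorder_not_less)
    moreover have "Lp_int (A k) q (\<lambda>z. complex_of_real w * f k z) = \<infinity>"
      using w f(2)[of k] A by (subst Lp_int_mult) (auto simp: fmeas ennreal_mult_eq_top_iff)
    ultimately show False by simp
  qed
  define \<G> where "\<G> = range (\<lambda>(k, N). E k N)"
  have Baire: "euclidean interior_of \<Union>\<G> = {}"
  proof (rule Baire_category_alt)
    show "completely_metrizable_space (euclidean :: (nat \<Rightarrow>\<^sub>C real) topology) \<or>
        locally_compact_space (euclidean :: (nat \<Rightarrow>\<^sub>C real) topology) \<and> regular_space (euclidean :: (nat \<Rightarrow>\<^sub>C real) topology)"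
      by (rule disjI1[OF completely_metrizable_space_bcontfun])
    show "countable \<G>" unfolding \<G>_def by simp
    show "closedin euclidean T \<and> euclidean interior_of T = {}" if "T \<in> \<G>" for T
      using that closed nowhere by (auto simp: \<G>_def)
  qed
  \<comment> \<open>Any \<open>a\<close> with norm below \<tau> moves \<open>g0\<close> by less than
    \<rho>, because the norms of \<open>H a\<close> are at most \<open>norm a\<close> times those of
    \<open>F\<close>.\<close>
  obtain \<tau> where \<tau>: "0 < \<tau>" "(\<Sum>j. (1/2) ^ Suc j *
      (\<tau> * Lp_norm \<Omega> (pexp q (Suc j)) F / (1 + \<tau> * Lp_norm \<Omega> (pexp q (Suc j)) F))) < \<rho>"
    using suminf_half_power_small[of "\<lambda>j. Lp_norm \<Omega> (pexp q (Suc j)) F" \<rho>] \<open>0 < \<rho>\<close> Lp_norm_nonneg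
    by blast
  \<comment> \<open>The union over all \<open>k\<close> and \<open>N\<close> has empty interior, so
    a single small \<open>a\<close> avoids every \<open>E k N\<close> and is singular on all
    \<open>A k\<close> at once.\<close>
  have "\<not> ball 0 \<tau> \<subseteq> \<Union>\<G>"
    using Baire \<tau>(1) by (metis centre_in_ball empty_iff interior_of_maximal open_ball open_openin subsetD)
  then obtain a where "a \<in> ball 0 \<tau>" "a \<notin> \<Union>\<G>"
    by blast
  then have a: "norm a < \<tau>" "\<And>k N. a \<notin> E k N"
    by (auto simp: \<G>_def)
  have "OLp_dist \<Omega> q g0 (G a) \<le> (\<Sum>j. (1/2) ^ Suc j *
      (\<tau> * Lp_norm \<Omega> (pexp q (Suc j)) F / (1 + \<tau> * Lp_norm \<Omega> (pexp q (Suc j)) F)))"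
    unfolding OLp_dist_def
  proof (intro suminf_le mult_left_mono divide_one_plus_mono Lp_norm_nonneg OLp_dist_summable
      summable_half_power_bounded)
    fix j
    have p: "1 \<le> pexp q (Suc j)" "pexp q (Suc j) < q"
      using pexp_bounds[OF q, of j] by auto
    have "Lp_norm \<Omega> (pexp q (Suc j)) (g0 - G a) = Lp_norm \<Omega> (pexp q (Suc j)) (H a)"
      by (rule Lp_norm_cong) (simp add: G_def)
    also have "\<dots> \<le> norm a * Lp_norm \<Omega> (pexp q (Suc j)) F"
      by (rule Hnorm[OF p order_refl])
    also have "\<dots> \<le> \<tau> * Lp_norm \<Omega> (pexp q (Suc j)) F"
      using a(1) by (intro mult_right_mono Lp_norm_nonneg) simp
    finally show "Lp_norm \<Omega> (pexp q (Suc j)) (g0 - G a) \<le> \<tau> * Lp_norm \<Omega> (pexp q (Suc j)) F" .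
  qed (use \<tau>(1) Lp_norm_nonneg in \<open>auto intro!: mult_nonneg_nonneg\<close>)
  then have "OLp_dist \<Omega> q g0 (G a) < \<rho>"
    using \<tau>(2) by linarith
  moreover have "Lp_int (A k) q (G a) = \<infinity>" for k
    using a(2) Lp_int_infinite_iff[OF \<Omega> q A GX, of k a] by (auto simp: E_def not_le)
  ultimately show ?thesis
    using GX by blast
qed

section \<open>Reduction to countably many balls\<close>

theorem theorem6:
  fixes \<Omega> :: "(complex ^ 'n) set" and q :: real
  assumes "open \<Omega>" and "bounded \<Omega>" and "q > 1"
    and "\<forall>\<eta>\<in>frontier \<Omega>. \<forall>\<epsilon>>0. \<exists>f \<in> OLp_below \<Omega> q. Lp_int (ball \<eta> \<epsilon> \<inter> \<Omega>) q f = \<infinity>"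
  shows "(OLp_topology \<Omega> q) closure_of (S_set \<Omega> q) = topspace (OLp_topology \<Omega> q)
         \<and> gdelta_in (OLp_topology \<Omega> q) (S_set \<Omega> q)"
proof -
  interpret Metric_space "OLp_below \<Omega> q" "OLp_dist \<Omega> q"
    by (rule Metric_space_OLp[OF assms(1,3)])
  obtain T where T: "countable T" "T \<subseteq> frontier \<Omega>" "frontier \<Omega> \<subseteq> closure T"
    using separable by blast
  \<comment> \<open>Centres are taken from the frontier itself, so the hypothesis provides a
    singular function for each of these sets.\<close>
  define \<B> where "\<B> = (\<lambda>(\<zeta>, m). ball \<zeta> (inverse (real (Suc m))) \<inter> \<Omega>) ` (T \<times> UNIV)"
  have countB: "countable \<B>"
    unfolding \<B>_def using T(1) by (intro countable_image countable_SIGMA) auto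
  have B: "A \<in> sets lebesgue" "A \<subseteq> \<Omega>" "\<exists>f \<in> OLp_below \<Omega> q. Lp_int A q f = \<infinity>" if "A \<in> \<B>" for A
    using that assms(1,4) T(2) unfolding \<B>_def
    by (auto simp: subset_iff simp del: of_nat_Suc intro!: borel_open open_Int)
  have S: "S_set \<Omega> q = {g \<in> OLp_below \<Omega> q. \<forall>A\<in>\<B>. Lp_int A q g = \<infinity>}"
  proof (intro equalityI subsetI CollectI conjI ballI)
    fix g A assume "g \<in> S_set \<Omega> q" "A \<in> \<B>"
    then show "Lp_int A q g = \<infinity>"
      using T(2) by (auto simp: S_set_def \<B>_def subset_iff simp del: of_nat_Suc)
  next
    fix g assume g: "g \<in> {g \<in> OLp_below \<Omega> q. \<forall>A\<in>\<B>. Lp_int A q g = \<infinity>}"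
    have "Lp_int (ball \<zeta> \<epsilon> \<inter> \<Omega>) q g = \<infinity>" if \<zeta>: "\<zeta> \<in> frontier \<Omega>" and "\<epsilon> > 0" for \<zeta> \<epsilon>
    proof -
      obtain m where m: "inverse (real (Suc m)) < \<epsilon> / 2"
        using reals_Archimedean[of "\<epsilon> / 2"] \<open>\<epsilon> > 0\<close> by auto
      obtain \<xi> where \<xi>: "\<xi> \<in> T" "dist \<xi> \<zeta> < \<epsilon> / 2"
        using \<zeta> T(3) \<open>\<epsilon> > 0\<close> closure_approachable[of \<zeta> T] half_gt_zero[of \<epsilon>] by blast
      \<comment> \<open>Distance of centres and radius are each below
        \<open>\<epsilon> / 2\<close>.\<close>
      have "ball \<xi> (inverse (real (Suc m))) \<subseteq> ball \<zeta> \<epsilon>"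
        using m \<xi>(2) by (subst ball_subset_ball_iff) (simp del: of_nat_Suc)
      then have "Lp_int (ball \<xi> (inverse (real (Suc m))) \<inter> \<Omega>) q g \<le> Lp_int (ball \<zeta> \<epsilon> \<inter> \<Omega>) q g"
        using assms(3) by (intro Lp_int_mono) auto
      moreover have "Lp_int (ball \<xi> (inverse (real (Suc m))) \<inter> \<Omega>) q g = \<infinity>"
        using g \<xi>(1) by (force simp: \<B>_def)
      ultimately show ?thesis
        by (simp add: top_unique)
    qed
    then show "g \<in> S_set \<Omega> q"
      using g by (auto simp: S_set_def)
  qed (auto simp: S_set_def)
  define U where "U A N = {g \<in> OLp_below \<Omega> q. \<exists>j. real N < Lp_norm A (pexp q (Suc j)) g}" for A N
  have top: "topspace (OLp_topology \<Omega> q) = OLp_below \<Omega> q"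
    by (simp add: OLp_topology_def)
  \<comment> \<open>Inserting the whole space keeps the intersection inside it even when \<B> is
    empty.\<close>
  have "S_set \<Omega> q = \<Inter>(insert (OLp_below \<Omega> q) ((\<lambda>(A, N). U A N) ` (\<B> \<times> UNIV)))"
    unfolding S using Lp_int_infinite_iff[OF assms(1-3) B(1,2)] by (auto simp: U_def)
  moreover have "gdelta_in (OLp_topology \<Omega> q) \<dots>"
  proof (rule gdelta_in_Inter)
    show "countable (insert (OLp_below \<Omega> q) ((\<lambda>(A, N). U A N) ` (\<B> \<times> UNIV)))"
      using countB by (intro countable_insert countable_image countable_SIGMA) auto
    show "gdelta_in (OLp_topology \<Omega> q) V"
      if "V \<in> insert (OLp_below \<Omega> q) ((\<lambda>(A, N). U A N) ` (\<B> \<times> UNIV))" for V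
      using that gdelta_in_topspace[of "OLp_topology \<Omega> q"]
        openin_OLp_Lp_norm_greater[OF assms(1,3) B(1,2)]
      unfolding top U_def by (auto intro: open_imp_gdelta_in)
  qed auto
  ultimately have gdelta: "gdelta_in (OLp_topology \<Omega> q) (S_set \<Omega> q)"
    by simp
  have "\<exists>h\<in>S_set \<Omega> q. OLp_dist \<Omega> q g h < r" if g: "g \<in> OLp_below \<Omega> q" and "r > 0" for g r
  \<comment> \<open>An empty \<B> has no enumeration, but then every element of the space lies in
    \<open>S_set\<close> and \<open>g\<close> itself serves.\<close>
  proof (cases "\<B> = {}")
    case True
    have "OLp_dist \<Omega> q g g < r" using zero[OF g g] \<open>r > 0\<close> by simp
    then show ?thesis using g True unfolding S by blast
  next
    case False
    have ran: "from_nat_into \<B> k \<in> \<B>" for k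
      by (rule from_nat_into[OF False])
    obtain h where h: "h \<in> OLp_below \<Omega> q" "OLp_dist \<Omega> q g h < r"
        "\<And>k. Lp_int (from_nat_into \<B> k) q h = \<infinity>"
      using exists_perturbation_infinite_Lp_int[where A="from_nat_into \<B>", OF assms(1-3) g \<open>r > 0\<close>
          B(1)[OF ran] B(2)[OF ran] B(3)[OF ran]]
      by auto
    have "Lp_int A q h = \<infinity>" if "A \<in> \<B>" for A
      using from_nat_into_surj[OF countB that] h(3) by auto
    then have "h \<in> S_set \<Omega> q"
      unfolding S using h(1) by simp
    then show ?thesis
      using h(2) by blast
  qed
  moreover have "h \<in> OLp_below \<Omega> q" if "h \<in> S_set \<Omega> q" for h
    using that by (simp add: S_set_def)
  ultimately have "(OLp_topology \<Omega> q) closure_of (S_set \<Omega> q) = OLp_below \<Omega> q"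
    unfolding OLp_topology_def metric_closure_of by (simp add: set_eq_iff) metis
  then show ?thesis
    using gdelta top by simp
qed

end
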